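(* Let $p\in(1,\infty)$, $\mu_1\in\mathcal P_{ac}(\Omega)$, $\mu_2\in\mathcal P(\Omega)$ and $t\in[0,1]$. Let $\bar\eta_2$ denote the unique minimizer of $\inf_{\eta_2\le_{cx}\mu_2}\mathrm{CMM}(\mu_1,\eta_2)$. Then a solution of $$\mathrm{wC}(\mu_1,\mu_2)=\inf_{\nu\in\mathcal P(\Omega)}t\,\mathcal T_p(\mu_2|\nu)+(1-t)\,\mathcal T_p(\nu|\mu_1)$$ is given through the $p$-Wasserstein geodesic $$\bar\nu=\big((1-s(t))\,\mathrm{id}+s(t)S\big)_{\#}\mu_1,$$ where $S$ is the $p$-Wasserstein optimal map from $\mu_1$ to $\bar\eta_2$ and $$s(t)=\frac{t^{\frac1{p-1}}}{t^{\frac1{p-1}}+(1-t)^{\frac1{p-1}}}.$$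
   Context: $\Omega\subset\mathbb R^d$ is a fixed compact convex set, $\mathcal P(\Omega)$ is the set of Borel probability measures on $\Omega$, and $\mathcal P_{ac}(\Omega)$ is the subset of those absolutely continuous with respect to Lebesgue measure. For $\mu,\nu\in\mathcal P(\Omega)$, $\Pi(\mu,\nu)$ is the set of couplings of $\mu$ and $\nu$ (first marginal $\mu$, second marginal $\nu$), and $W_p(\mu,\nu)^p=\inf_{\gamma\in\Pi(\mu,\nu)}\int_{\Omega^2}|x-y|^p\,d\gamma(x,y)$. A $p$-Wasserstein optimal map from $\mu$ to $\nu$ is a map $T$ such that $(\mathrm{id}\times T)_\#\mu$ minimizes $W_p^p(\mu,\nu)$; $\#$ denotes pushforward. The weak optimal transport cost with barycentric cost is $$\mathcal T_p(\nu|\mu)=\inf_{\gamma\in\Pi(\mu,\nu)}\int_\Omega\Big|x-\int_\Omega y\,d\gamma_x(y)\Big|^p\,d\mu(x),$$ where $d\gamma(x,y)=d\gamma_x(y)\,d\mu(x)$ is the disintegration with respect to the first marginal. Convex order: for $\eta,\mu\in\mathcal P(\Omega)$, $\eta\le_{cx}\mu$ means $\int_\Omega\varphi\,d\eta\le\int_\Omega\varphi\,d\mu$ for all convex $\varphi:\mathbb R^d\to\mathbb R$. For $\mu_1,\eta_2\in\mathcal P(\Omega)$, $\mathrm{CMM}(\mu_1,\eta_2)=\inf_{\gamma\in\Pi(\mu_1,\eta_2)}\int_{\Omega^2}\bar c_t\,d\gamma$ with $\bar c_t(x_1,x_2)=\inf_{z\in\Omega}\,t|x_2-z|^p+(1-t)|z-x_1|^p$.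 *)

theory Defs
  imports "HOL-Probability.Probability"
begin

text \<open>
  A Borel probability measure on \<open>\<Omega>\<close> is represented as a Borel probability measure on the ambient
  Euclidean space that gives \<open>\<Omega>\<close> full mass. Integrals over \<open>\<Omega>\<close> against such a measure are
  therefore written as integrals over the whole space.
\<close>

definition prob_on :: "'a::euclidean_space set \<Rightarrow> 'a measure set" where
  "prob_on \<Omega> = {\<mu>. prob_space \<mu> \<and> sets \<mu> = sets borel \<and> emeasure \<mu> \<Omega> = 1}"

definition prob_ac_on :: "'a::euclidean_space set \<Rightarrow> 'a measure set" where
  "prob_ac_on \<Omega> = {\<mu> \<in> prob_on \<Omega>. absolutely_continuous lborel \<mu>}"

definition couplings ::
    "'a::euclidean_space measure \<Rightarrow> 'a measure \<Rightarrow> ('a \<times> 'a) measure set" where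
  "couplings \<mu> \<nu> = {\<gamma>. sets \<gamma> = sets (borel \<Otimes>\<^sub>M borel) \<and>
     distr \<gamma> borel fst = \<mu> \<and> distr \<gamma> borel snd = \<nu>}"

definition wasserstein_pow :: "real \<Rightarrow> 'a::euclidean_space measure \<Rightarrow> 'a measure \<Rightarrow> ennreal" where
  "wasserstein_pow p \<mu> \<nu> =
     (INF \<gamma>\<in>couplings \<mu> \<nu>. \<integral>\<^sup>+(x, y). ennreal (norm (x - y) powr p) \<partial>\<gamma>)"

definition wasserstein_optimal_map ::
    "real \<Rightarrow> 'a::euclidean_space measure \<Rightarrow> 'a measure \<Rightarrow> ('a \<Rightarrow> 'a) \<Rightarrow> bool" where
  "wasserstein_optimal_map p \<mu> \<nu> T \<longleftrightarrow>
     T \<in> borel_measurable borel \<and>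
     (let \<gamma> = distr \<mu> (borel \<Otimes>\<^sub>M borel) (\<lambda>x. (x, T x)) in
        \<gamma> \<in> couplings \<mu> \<nu> \<and>
        (\<integral>\<^sup>+(x, y). ennreal (norm (x - y) powr p) \<partial>\<gamma>) = wasserstein_pow p \<mu> \<nu>)"

text \<open>\<open>d\<gamma>(x,y) = d\<kappa>\<^sub>x(y) d\<mu>(x)\<close> for a probability kernel \<open>\<kappa>\<close>.\<close>

definition disintegrates ::
    "('a::euclidean_space \<times> 'a) measure \<Rightarrow> 'a measure \<Rightarrow> ('a \<Rightarrow> 'a measure) \<Rightarrow> bool" where
  "disintegrates \<gamma> \<mu> \<kappa> \<longleftrightarrow>
     \<kappa> \<in> borel \<rightarrow>\<^sub>M prob_algebra borel \<and>
     (\<forall>A\<in>sets (borel \<Otimes>\<^sub>M borel).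
        emeasure \<gamma> A = (\<integral>\<^sup>+x. (\<integral>\<^sup>+y. indicator A (x, y) \<partial>\<kappa> x) \<partial>\<mu>))"

text \<open>
  The cost \<open>\<T>\<^sub>p(\<nu>|\<mu>)\<close>; note the order of the arguments. The kernel \<open>\<kappa>\<close> is determined by \<open>\<gamma>\<close> up to a
  \<open>\<mu>\<close>-null set, so ranging over all disintegrations of \<open>\<gamma>\<close> does not change the infimum.
\<close>

definition weak_cost :: "real \<Rightarrow> 'a::euclidean_space measure \<Rightarrow> 'a measure \<Rightarrow> ennreal" where
  "weak_cost p \<nu> \<mu> =
     (INF (\<gamma>, \<kappa>)\<in>{(\<gamma>, \<kappa>). \<gamma> \<in> couplings \<mu> \<nu> \<and> disintegrates \<gamma> \<mu> \<kappa>}.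
        \<integral>\<^sup>+x. ennreal (norm (x - (\<integral>y. y \<partial>\<kappa> x)) powr p) \<partial>\<mu>)"

definition convex_order :: "'a::euclidean_space measure \<Rightarrow> 'a measure \<Rightarrow> bool" (infix \<open>\<le>\<^sub>c\<^sub>x\<close> 50) where
  "\<eta> \<le>\<^sub>c\<^sub>x \<mu> \<longleftrightarrow> (\<forall>\<phi>::'a \<Rightarrow> real. convex_on UNIV \<phi> \<longrightarrow> (\<integral>x. \<phi> x \<partial>\<eta>) \<le> (\<integral>x. \<phi> x \<partial>\<mu>))"

definition cmm_cost ::
    "'a::euclidean_space set \<Rightarrow> real \<Rightarrow> real \<Rightarrow> 'a \<Rightarrow> 'a \<Rightarrow> real" where
  "cmm_cost \<Omega> p t x1 x2 =
     (INF z\<in>\<Omega>. t * norm (x2 - z) powr p + (1 - t) * norm (z - x1) powr p)"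

definition CMM ::
    "'a::euclidean_space set \<Rightarrow> real \<Rightarrow> real \<Rightarrow> 'a measure \<Rightarrow> 'a measure \<Rightarrow> ennreal" where
  "CMM \<Omega> p t \<mu>1 \<eta>2 =
     (INF \<gamma>\<in>couplings \<mu>1 \<eta>2. \<integral>\<^sup>+(x1, x2). ennreal (cmm_cost \<Omega> p t x1 x2) \<partial>\<gamma>)"

definition wC_objective ::
    "real \<Rightarrow> real \<Rightarrow> 'a::euclidean_space measure \<Rightarrow> 'a measure \<Rightarrow> 'a measure \<Rightarrow> ennreal" where
  "wC_objective p t \<mu>1 \<mu>2 \<nu> =
     ennreal t * weak_cost p \<mu>2 \<nu> + ennreal (1 - t) * weak_cost p \<nu> \<mu>1"

definition wC ::
    "'a::euclidean_space set \<Rightarrow> real \<Rightarrow> real \<Rightarrow> 'a measure \<Rightarrow> 'a measure \<Rightarrow> ennreal" where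
  "wC \<Omega> p t \<mu>1 \<mu>2 = (INF \<nu>\<in>prob_on \<Omega>. wC_objective p t \<mu>1 \<mu>2 \<nu>)"

text \<open>As \<open>0 powr a = 0\<close>, this gives \<open>0\<close> at \<open>t = 0\<close> and \<open>1\<close> at \<open>t = 1\<close>.\<close>

definition geodesic_time :: "real \<Rightarrow> real \<Rightarrow> real" where
  "geodesic_time p t =
     t powr (1 / (p - 1)) / (t powr (1 / (p - 1)) + (1 - t) powr (1 / (p - 1)))"

end

theory Submission
  imports Defs
begin

text \<open>
  Write \<open>s = s(t)\<close> and \<open>C = t (1 - s)\<^sup>p + (1 - t) s\<^sup>p\<close>. For points of the convex set \<open>\<Omega>\<close> the cost
  \<open>cmm_cost\<close> is \<open>C |x\<^sub>1 - x\<^sub>2|\<^sup>p\<close>, the infimum being attained at \<open>(1 - s) x\<^sub>1 + s x\<^sub>2\<close>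
  (\<open>cmm_cost_eq\<close>). Hence \<open>CMM(\<mu>\<^sub>1, \<eta>)\<close> equals \<open>C W\<^sub>p\<^sup>p(\<mu>\<^sub>1, \<eta>)\<close>, and the theorem follows
  from a lower bound valid for every competitor \<open>\<nu>\<close> and a matching upper bound for the geodesic.

  Lower bound (\<open>CMM_le_kernel_costs\<close>). Let \<open>\<kappa>\<^sub>1\<close> be a kernel from \<open>\<mu>\<^sub>1\<close> to \<open>\<nu>\<close> with barycenters \<open>b\<^sub>1\<close>,
  and \<open>\<kappa>\<^sub>2\<close> a kernel from \<open>\<nu>\<close> to \<open>\<mu>\<^sub>2\<close> with barycenters \<open>b\<^sub>2\<close>. The composed kernel leads from \<open>\<mu>\<^sub>1\<close>
  to \<open>\<mu>\<^sub>2\<close>; let \<open>w(x)\<close> be its barycenter at \<open>x\<close> and \<open>\<eta>\<close> the law of \<open>w\<close> under \<open>\<mu>\<^sub>1\<close>. Jensen's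
  inequality for convex functions gives \<open>\<eta> \<le>\<^sub>c\<^sub>x \<mu>\<^sub>2\<close>. Moreover \<open>w(x) - b\<^sub>1(x)\<close> is the mean of
  \<open>b\<^sub>2(z) - z\<close> under \<open>\<kappa>\<^sub>1(x)\<close>, so Jensen's inequality for \<open>|.|\<^sup>p\<close> bounds the objective from below by
  the integral of \<open>t |w - b\<^sub>1|\<^sup>p + (1 - t) |b\<^sub>1 - x|\<^sup>p \<ge> C |x - w|\<^sup>p\<close>, which is at least
  \<open>CMM(\<mu>\<^sub>1, \<eta>)\<close> and hence at least the minimal value \<open>CMM(\<mu>\<^sub>1, \<eta>\<^sub>2)\<close>.

  Upper bound (\<open>wC_objective_geodesic_le\<close>). With \<open>T = (1 - s) id + s S\<close>, the map \<open>T\<close> itself shows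
  that the cost from \<open>\<mu>\<^sub>1\<close> to the law of \<open>T\<close> is at most \<open>s\<^sup>p \<integral>|x - S x|\<^sup>p d\<mu>\<^sub>1\<close>. What remains is that
  the weak cost from the law of \<open>T\<close> to \<open>\<mu>\<^sub>2\<close> is at most \<open>\<integral>|T x - S x|\<^sup>p d\<mu>\<^sub>1\<close> whenever the law of
  \<open>S\<close> is below \<open>\<mu>\<^sub>2\<close> in convex order (\<open>weak_cost_le_transport\<close>). By Strassen's theorem a
  martingale kernel leads from the law of \<open>S\<close> to \<open>\<mu>\<^sub>2\<close>, and conditioning on \<open>T\<close> gives the claim.
  As the cost is an infimum, a martingale property up to an arbitrarily small error is enough, and
  this is a finite-dimensional statement: after grouping the points of \<open>\<Omega>\<close> into finitely many
  small cells, the wanted plan is a matrix with prescribed row sums, column sums and approximately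
  prescribed row moments. If there were none, a separating hyperplane would produce a maximum of
  finitely many affine functions that violates the convex order (\<open>transport_plan_duality\<close>,
  \<open>approximate_martingale_plan\<close>). The matrix is spread over the cells by a density with respect to a
  product measure, so that no general disintegration is involved (\<open>density_kernel\<close>).
\<close>

section \<open>Powers and the displacement cost\<close>

text \<open>
  The tangent line inequality on the closed half-line. All inequalities of Jensen type for powers
  below integrate it at the mean value.
\<close>

lemma powr_above_tangent:
  fixes a g p :: real
  assumes "1 < p" "0 \<le> a" "0 \<le> g"
  shows "a powr p + p * a powr (p - 1) * (g - a) \<le> g powr p"
proof (cases "a = 0 \<or> g = 0")
  case True
  then show ?thesis
  proof
    assume "g = 0"
    have "a powr (p - 1) * a = a powr p"
      using assms powr_add[of a "p - 1" 1] by (cases "a = 0") simp_all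
    moreover have "a powr p \<le> p * a powr p"
      using assms by (simp add: mult_le_cancel_right1)
    ultimately show ?thesis using assms \<open>g = 0\<close> by (simp add: mult.assoc)
  qed (use assms in simp)
next
  case False
  then have "a > 0" "g > 0" using assms by auto
  have d: "((\<lambda>x. x powr p) has_real_derivative p * a powr (p - 1)) (at a within {0<..})"
    using has_real_derivative_powr[OF \<open>a > 0\<close>] by (rule has_field_derivative_at_within)
  have "g powr p - a powr p \<ge> p * a powr (p - 1) * (g - a)"
  proof (rule convex_on_imp_above_tangent[OF powr_convex _ _ _ d])
    show "1 \<le> p" using assms by simp
    show "connected {0::real<..}" by simp
    show "a \<in> interior {0<..}" using \<open>a > 0\<close> by (simp add: interior_open)
    show "g \<in> {0<..}" using \<open>g > 0\<close> by simp
  qed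
  then show ?thesis by simp
qed

lemma powr_add_le_linear:
  fixes u v p M :: real
  assumes "1 < p" "0 \<le> u" "0 \<le> v" "u + v \<le> M"
  shows "(u + v) powr p \<le> u powr p + p * M powr (p - 1) * v"
proof -
  have "(u + v) powr p + p * (u + v) powr (p - 1) * (u - (u + v)) \<le> u powr p"
    using assms by (intro powr_above_tangent) auto
  moreover have "p * (u + v) powr (p - 1) * v \<le> p * M powr (p - 1) * v"
    using assms by (intro mult_right_mono mult_left_mono powr_mono2) auto
  ultimately show ?thesis by (simp add: algebra_simps)
qed

text \<open>
  Convexity of the power function at \<open>a + b = (1 - s) (a / (1 - s)) + s (b / s)\<close>.
\<close>

lemma powr_add_le_weighted:
  fixes a b s p :: real
  assumes "1 < p" "0 < s" "s < 1" "0 \<le> a" "0 \<le> b"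
  shows "(a + b) powr p \<le> (1 - s) powr (1 - p) * a powr p + s powr (1 - p) * b powr p"
proof -
  let ?D = "a + b"
  have 1: "(1 - s) * (?D powr p + p * ?D powr (p - 1) * (a / (1 - s) - ?D)) \<le> (1 - s) * (a / (1 - s)) powr p"
    using assms by (intro mult_left_mono powr_above_tangent) auto
  have 2: "s * (?D powr p + p * ?D powr (p - 1) * (b / s - ?D)) \<le> s * (b / s) powr p"
    using assms by (intro mult_left_mono powr_above_tangent) auto
  have "(1 - s) * (?D powr p + p * ?D powr (p - 1) * (a / (1 - s) - ?D))
      + s * (?D powr p + p * ?D powr (p - 1) * (b / s - ?D))
      = ?D powr p + p * ?D powr (p - 1) * ((1 - s) * (a / (1 - s)) + s * (b / s) - ?D)"
    by (simp only: algebra_simps)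
  also have "\<dots> = ?D powr p" using assms by simp
  finally have "?D powr p \<le> (1 - s) * (a / (1 - s)) powr p + s * (b / s) powr p"
    using 1 2 by linarith
  also have "(1 - s) * (a / (1 - s)) powr p = (1 - s) powr (1 - p) * a powr p"
    using assms by (simp add: powr_divide powr_diff)
  also have "s * (b / s) powr p = s powr (1 - p) * b powr p"
    using assms by (simp add: powr_divide powr_diff)
  finally show ?thesis .
qed

text \<open>
  The factor by which optimal splitting of the displacement multiplies \<open>|x\<^sub>1 - x\<^sub>2|\<^sup>p\<close>.
\<close>

definition geodesic_const :: "real \<Rightarrow> real \<Rightarrow> real" where
  "geodesic_const p t =
     t * (1 - geodesic_time p t) powr p + (1 - t) * geodesic_time p t powr p"

lemma geodesic_time_bounds:
  assumes "0 \<le> t" "t \<le> 1"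
  shows "0 \<le> geodesic_time p t" "geodesic_time p t \<le> 1"
proof -
  define A where "A = t powr (1 / (p - 1))"
  define B where "B = (1 - t) powr (1 / (p - 1))"
  have AB: "0 \<le> A" "0 \<le> B" by (simp_all add: A_def B_def)
  have e: "geodesic_time p t = A / (A + B)" unfolding geodesic_time_def A_def B_def ..
  show "0 \<le> geodesic_time p t" unfolding e using AB by simp
  show "geodesic_time p t \<le> 1"
  proof (cases "A + B = 0")
    case True
    show ?thesis unfolding e True by simp
  next
    case False
    have "0 < A + B" using add_nonneg_nonneg[OF AB] False by (metis order_less_le)
    moreover have "A \<le> 1 * (A + B)" using AB(2) by simp
    ultimately show ?thesis unfolding e by (rule mult_imp_div_pos_le)
  qed
qed

lemma geodesic_const_nonneg: "0 \<le> t \<Longrightarrow> t \<le> 1 \<Longrightarrow> 0 \<le> geodesic_const p t"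
  by (simp add: geodesic_const_def)

text \<open>
  The splitting ratio \<open>s\<close> is the one for which \<open>t (1 - s)\<^sup>p\<^sup>-\<^sup>1 = (1 - t) s\<^sup>p\<^sup>-\<^sup>1\<close>; both sides then equal
  the constant. This makes the weights of \<open>powr_add_le_weighted\<close>, multiplied by the constant, exactly
  \<open>t\<close> and \<open>1 - t\<close>.
\<close>

lemma geodesic_const_interior:
  assumes "1 < p" "0 < t" "t < 1"
  defines "s \<equiv> geodesic_time p t"
  shows "0 < s" "s < 1"
    "geodesic_const p t * (1 - s) powr (1 - p) = t"
    "geodesic_const p t * s powr (1 - p) = 1 - t"
proof -
  define A where "A = t powr (1 / (p - 1))"
  define B where "B = (1 - t) powr (1 / (p - 1))"
  have AB: "A > 0" "B > 0" using assms by (auto simp: A_def B_def)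
  have s: "s = A / (A + B)" unfolding s_def geodesic_time_def A_def B_def ..
  have s': "1 - s = B / (A + B)" using AB by (simp add: s field_simps)
  show s01: "0 < s" "s < 1" using AB by (auto simp: s)
  have Ap: "A powr (p - 1) = t" using assms by (simp add: A_def powr_powr)
  have Bp: "B powr (p - 1) = 1 - t" using assms by (simp add: B_def powr_powr)
  have e: "t * (1 - s) powr (p - 1) = (1 - t) * s powr (p - 1)"
    unfolding s' unfolding s using AB by (simp add: powr_divide Ap Bp)
  have pw: "x powr p = x powr (p - 1) * x" if "x > 0" for x :: real
    using powr_add[of x "p - 1" 1] that by simp
  have "geodesic_const p t = t * (1 - s) powr (p - 1) * (1 - s) + (1 - t) * s powr (p - 1) * s"
    using s01 pw[of s] pw[of "1 - s"] by (simp add: geodesic_const_def s_def[symmetric])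
  then have c1: "geodesic_const p t = t * (1 - s) powr (p - 1)"
    unfolding e by (simp add: algebra_simps)
  then have c2: "geodesic_const p t = (1 - t) * s powr (p - 1)" using e by simp
  have inv: "x powr (p - 1) * x powr (1 - p) = 1" if "x > 0" for x :: real
    using powr_add[of x "p - 1" "1 - p"] that by simp
  show "geodesic_const p t * (1 - s) powr (1 - p) = t"
    unfolding c1 using inv[of "1 - s"] s01 by (simp add: mult.assoc)
  show "geodesic_const p t * s powr (1 - p) = 1 - t"
    unfolding c2 using inv[of s] s01 by (simp add: mult.assoc)
qed

text \<open>
  Going from \<open>x\<close> to \<open>y\<close> through \<open>z\<close> never beats the straight path: triangle inequality followed by
  \<open>powr_add_le_weighted\<close>. For \<open>t = 0\<close> and \<open>t = 1\<close> the constant vanishes.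
\<close>

lemma geodesic_const_le:
  fixes x z y :: "'a::euclidean_space"
  assumes "1 < p" "0 \<le> t" "t \<le> 1"
  shows "geodesic_const p t * norm (x - y) powr p
    \<le> t * norm (y - z) powr p + (1 - t) * norm (z - x) powr p"
proof (cases "t = 0 \<or> t = 1")
  case True
  have "geodesic_const p t = 0"
    using True assms by (auto simp: geodesic_const_def geodesic_time_def)
  then show ?thesis using assms by simp
next
  case False
  then have t: "0 < t" "t < 1" using assms by auto
  define s where "s = geodesic_time p t"
  note c = geodesic_const_interior[OF assms(1) t, folded s_def]
  have "norm (x - y) \<le> norm (y - z) + norm (z - x)"
    using norm_triangle_ineq[of "y - z" "z - x"] by (simp add: norm_minus_commute)
  then have "norm (x - y) powr p \<le> (norm (y - z) + norm (z - x)) powr p"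
    using assms by (intro powr_mono2) auto
  also have "\<dots> \<le> (1 - s) powr (1 - p) * norm (y - z) powr p + s powr (1 - p) * norm (z - x) powr p"
    by (intro powr_add_le_weighted assms c) auto
  finally have "geodesic_const p t * norm (x - y) powr p \<le> geodesic_const p t * \<dots>"
    using geodesic_const_nonneg assms by (intro mult_left_mono) auto
  also have "\<dots> = (geodesic_const p t * (1 - s) powr (1 - p)) * norm (y - z) powr p
      + (geodesic_const p t * s powr (1 - p)) * norm (z - x) powr p"
    by (simp add: algebra_simps)
  finally show ?thesis unfolding c .
qed

lemma cmm_cost_eq:
  fixes x1 x2 :: "'a::euclidean_space"
  assumes "1 < p" "0 \<le> t" "t \<le> 1" "convex \<Omega>" "x1 \<in> \<Omega>" "x2 \<in> \<Omega>"
  shows "cmm_cost \<Omega> p t x1 x2 = geodesic_const p t * norm (x1 - x2) powr p"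
proof -
  define s where "s = geodesic_time p t"
  define z where "z = (1 - s) *\<^sub>R x1 + s *\<^sub>R x2"
  have s: "0 \<le> s" "s \<le> 1" using geodesic_time_bounds assms by (auto simp: s_def)
  have z: "z \<in> \<Omega>" unfolding z_def using assms s by (intro convexD) auto
  have "x2 - z = (1 - s) *\<^sub>R (x2 - x1)" "z - x1 = s *\<^sub>R (x2 - x1)"
    by (simp_all add: z_def algebra_simps)
  then have nz: "norm (x2 - z) = (1 - s) * norm (x1 - x2)" "norm (z - x1) = s * norm (x1 - x2)"
    using s by (simp_all only: norm_scaleR norm_minus_commute[of x2 x1] abs_of_nonneg diff_ge_0_iff_ge)
  have v: "t * norm (x2 - z) powr p + (1 - t) * norm (z - x1) powr p
      = geodesic_const p t * norm (x1 - x2) powr p"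
    unfolding nz geodesic_const_def s_def[symmetric] using s by (simp add: powr_mult distrib_right)
  show ?thesis unfolding cmm_cost_def
  proof (rule antisym)
    have "bdd_below ((\<lambda>z. t * norm (x2 - z) powr p + (1 - t) * norm (z - x1) powr p) ` \<Omega>)"
      using assms by (intro bdd_belowI2[of _ 0]) auto
    from cINF_lower[OF this z]
    show "(INF z\<in>\<Omega>. t * norm (x2 - z) powr p + (1 - t) * norm (z - x1) powr p)
        \<le> geodesic_const p t * norm (x1 - x2) powr p"
      unfolding v .
    show "geodesic_const p t * norm (x1 - x2) powr p
        \<le> (INF z\<in>\<Omega>. t * norm (x2 - z) powr p + (1 - t) * norm (z - x1) powr p)"
      using assms by (intro cINF_greatest geodesic_const_le) auto
  qed
qed

section \<open>Jensen inequalities on compact convex sets\<close>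

lemma prob_onD:
  assumes "\<mu> \<in> prob_on \<Omega>"
  shows "prob_space \<mu>" "sets \<mu> = sets borel" "space \<mu> = UNIV" "\<Omega> \<in> sets borel \<Longrightarrow> AE x in \<mu>. x \<in> \<Omega>"
proof -
  show 1: "prob_space \<mu>" and 2: "sets \<mu> = sets borel" using assms by (auto simp: prob_on_def)
  show "space \<mu> = UNIV" using sets_eq_imp_space_eq[OF 2] by simp
  assume "\<Omega> \<in> sets borel"
  moreover have "emeasure \<mu> \<Omega> = 1" using assms by (simp add: prob_on_def)
  ultimately show "AE x in \<mu>. x \<in> \<Omega>"
    using prob_space.AE_in_set_eq_1[OF 1, of \<Omega>] 2 by (simp add: measure_def)
qed

lemma prob_onI:
  assumes "prob_space \<mu>" "sets \<mu> = sets borel" "\<Omega> \<in> sets borel" "AE x in \<mu>. x \<in> \<Omega>"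
  shows "\<mu> \<in> prob_on \<Omega>"
proof -
  have "measure \<mu> \<Omega> = 1"
    using prob_space.AE_in_set_eq_1[OF assms(1), of \<Omega>] assms by simp
  then have "emeasure \<mu> \<Omega> = 1"
    using finite_measure.emeasure_eq_measure[OF prob_space.finite_measure[OF assms(1)], of \<Omega>] by simp
  then show ?thesis using assms by (simp add: prob_on_def)
qed

lemma integrable_AE_compact:
  fixes f :: "'b \<Rightarrow> 'a::euclidean_space"
  assumes "finite_measure M" "f \<in> borel_measurable M" "AE x in M. f x \<in> \<Omega>" "compact \<Omega>"
  shows "integrable M f"
proof -
  interpret finite_measure M by fact
  obtain B where "\<And>y. y \<in> \<Omega> \<Longrightarrow> norm y \<le> B"
    using compact_imp_bounded[OF assms(4)] by (auto simp: bounded_iff)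
  then have "AE x in M. norm (f x) \<le> B" using assms(3) by (auto elim!: eventually_mono)
  then show ?thesis using assms(2) by (rule integrable_const_bound)
qed

lemma integral_mem_compact_convex:
  fixes f :: "'b \<Rightarrow> 'a::euclidean_space"
  assumes "prob_space M" "f \<in> borel_measurable M" "AE x in M. f x \<in> \<Omega>" "compact \<Omega>" "convex \<Omega>"
  shows "(\<integral>x. f x \<partial>M) \<in> \<Omega>"
proof (rule ccontr)
  interpret prob_space M by fact
  assume "(\<integral>x. f x \<partial>M) \<notin> \<Omega>"
  then obtain a b where ab: "a \<bullet> (\<integral>x. f x \<partial>M) < b" "\<And>x. x \<in> \<Omega> \<Longrightarrow> b < a \<bullet> x"
    using separating_hyperplane_closed_point[OF assms(5) compact_imp_closed[OF assms(4)]] by blast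
  have i: "integrable M f" using assms by (intro integrable_AE_compact) unfold_locales
  have "(\<integral>x. b \<partial>M) \<le> (\<integral>x. a \<bullet> f x \<partial>M)"
    using assms(3) i ab(2)
    by (intro integral_mono_AE) (auto elim!: eventually_mono intro: less_imp_le)
  also have "\<dots> = a \<bullet> (\<integral>x. f x \<partial>M)" using i by simp
  finally show False using ab(1) by (simp add: prob_space)
qed

lemma convex_bounded_on_compact:
  fixes \<phi> :: "'a::euclidean_space \<Rightarrow> real"
  assumes "convex_on UNIV \<phi>" "compact \<Omega>"
  shows "\<phi> \<in> borel_measurable borel" "\<exists>B. \<forall>y\<in>\<Omega>. \<bar>\<phi> y\<bar> \<le> B"
proof -
  have cont: "continuous_on UNIV \<phi>" using convex_on_continuous[OF open_UNIV assms(1)] .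
  then show "\<phi> \<in> borel_measurable borel" by (rule borel_measurable_continuous_onI)
  have "compact (\<phi> ` \<Omega>)" using assms cont continuous_on_subset by (intro compact_continuous_image) auto
  then show "\<exists>B. \<forall>y\<in>\<Omega>. \<bar>\<phi> y\<bar> \<le> B" by (auto dest!: compact_imp_bounded simp: bounded_iff)
qed

text \<open>
  A hyperplane separating the closed epigraph from a point slightly below the graph. An affine
  minorant that is almost tangent suffices for Jensen's inequality.
\<close>

lemma convex_on_affine_minorant:
  fixes \<phi> :: "'a::euclidean_space \<Rightarrow> real"
  assumes "convex_on UNIV \<phi>" "0 < \<epsilon>"
  obtains v where "\<And>y. \<phi> b - \<epsilon> + v \<bullet> (y - b) \<le> \<phi> y"
proof -
  have cont: "continuous_on UNIV \<phi>" using convex_on_continuous[OF open_UNIV assms(1)] .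
  have "closed {xy. \<phi> (fst xy) \<le> snd xy}"
    by (intro closed_Collect_le continuous_intros continuous_on_compose2[OF cont]) auto
  then have "closed (epigraph UNIV \<phi>)" by (simp add: epigraph_def)
  moreover have "convex (epigraph UNIV \<phi>)" using assms by (simp add: convex_epigraph)
  moreover have "(b, \<phi> b - \<epsilon>) \<notin> epigraph UNIV \<phi>" using assms by (simp add: epigraph_def)
  ultimately obtain a \<beta> where ab: "a \<bullet> (b, \<phi> b - \<epsilon>) < \<beta>" "\<And>x. x \<in> epigraph UNIV \<phi> \<Longrightarrow> a \<bullet> x > \<beta>"
    using separating_hyperplane_closed_point[of "epigraph UNIV \<phi>" "(b, \<phi> b - \<epsilon>)"] by blast
  obtain u \<alpha> where a: "a = (u, \<alpha>)" by force
  have pos: "u \<bullet> b + \<alpha> * (\<phi> b - \<epsilon>) < u \<bullet> y + \<alpha> * \<phi> y" for y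
    using ab(1) ab(2)[of "(y, \<phi> y)"] by (simp add: a epigraph_def)
  \<comment> \<open>The hyperplane is not vertical, since the excluded point lies straight below the graph.\<close>
  from pos[of b] have "\<alpha> * \<epsilon> > 0" by (simp add: algebra_simps)
  then have \<alpha>: "\<alpha> > 0" using assms(2) by (simp add: zero_less_mult_iff)
  show thesis
  proof (rule that[of "- (1 / \<alpha>) *\<^sub>R u"])
    fix y
    have "\<alpha> * (\<phi> b - \<epsilon> + (- (1 / \<alpha>) *\<^sub>R u) \<bullet> (y - b)) = \<alpha> * (\<phi> b - \<epsilon>) + u \<bullet> b - u \<bullet> y"
      using \<alpha> by (simp add: algebra_simps)
    also have "\<dots> \<le> \<alpha> * \<phi> y" using pos[of y] by simp
    finally show "\<phi> b - \<epsilon> + (- (1 / \<alpha>) *\<^sub>R u) \<bullet> (y - b) \<le> \<phi> y"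
      using \<alpha> by (simp add: mult_le_cancel_left_pos)
  qed
qed

lemma jensen_convex_compact:
  fixes \<phi> :: "'a::euclidean_space \<Rightarrow> real"
  assumes "convex_on UNIV \<phi>" "prob_space M" "f \<in> borel_measurable M" "AE x in M. f x \<in> \<Omega>" "compact \<Omega>"
  shows "\<phi> (\<integral>x. f x \<partial>M) \<le> (\<integral>x. \<phi> (f x) \<partial>M)"
proof (rule field_le_epsilon)
  interpret prob_space M by fact
  fix \<epsilon> :: real assume "0 < \<epsilon>"
  let ?b = "\<integral>x. f x \<partial>M"
  obtain v where v: "\<And>y. \<phi> ?b - \<epsilon> + v \<bullet> (y - ?b) \<le> \<phi> y"
    using convex_on_affine_minorant[OF assms(1) \<open>0 < \<epsilon>\<close>] by blast
  note m[measurable] = convex_bounded_on_compact(1)[OF assms(1,5)]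
  obtain B where B: "\<And>y. y \<in> \<Omega> \<Longrightarrow> \<bar>\<phi> y\<bar> \<le> B" using convex_bounded_on_compact(2)[OF assms(1,5)] by blast
  have i: "integrable M f" using assms by (intro integrable_AE_compact) unfold_locales
  have j: "integrable M (\<lambda>x. \<phi> (f x))"
    using assms(4) B measurable_compose[OF assms(3) m]
    by (intro integrable_const_bound[of _ B]) (auto elim!: eventually_mono)
  have "\<phi> ?b - \<epsilon> = (\<integral>x. \<phi> ?b - \<epsilon> + v \<bullet> (f x - ?b) \<partial>M)"
    using i by (simp add: prob_space inner_diff_right)
  also have "\<dots> \<le> (\<integral>x. \<phi> (f x) \<partial>M)"
    using i j v by (intro integral_mono) auto
  finally show "\<phi> ?b \<le> (\<integral>x. \<phi> (f x) \<partial>M) + \<epsilon>" by simp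
qed

lemma integrable_indicator_finite_measure:
  assumes "finite_measure M" "A \<in> sets M"
  shows "integrable M (indicator A :: 'b \<Rightarrow> real)"
  using assms(2) by (intro finite_measure.integrable_const_bound[OF assms(1), of _ 1]) auto

text \<open>
  Jensen's inequality for \<open>g\<^sup>p\<close> on a set that need not have mass one, with the mean value \<open>a\<close> given by
  its defining equation, so that a null set is no exception.
\<close>

lemma powr_mean_le:
  fixes g :: "'b \<Rightarrow> real"
  assumes "finite_measure M" "1 < p" "A \<in> sets M" "integrable M g" "integrable M (\<lambda>x. g x powr p)"
    and "AE x in M. 0 \<le> g x" and a: "a * measure M A = (\<integral>x. indicator A x * g x \<partial>M)" "0 \<le> a"
  shows "measure M A * a powr p \<le> (\<integral>x. indicator A x * g x powr p \<partial>M)"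
proof -
  interpret finite_measure M by fact
  have i: "integrable M (\<lambda>x. indicator A x * g x)" "integrable M (\<lambda>x. indicator A x * g x powr p)"
    using integrable_mult_indicator[OF assms(3,4)] integrable_mult_indicator[OF assms(3,5)] by simp_all
  note ind = integrable_indicator_finite_measure[OF assms(1,3)]
  have "measure M A * a powr p
      = measure M A * (a powr p - p * a powr (p - 1) * a) + p * a powr (p - 1) * (a * measure M A)"
    by (simp add: algebra_simps)
  also have "\<dots> = (\<integral>x. indicator A x * (a powr p - p * a powr (p - 1) * a)
      + p * a powr (p - 1) * (indicator A x * g x) \<partial>M)"
  proof -
    have "(\<integral>x. indicator A x * C + D * (indicator A x * g x) \<partial>M)
        = measure M A * C + D * (\<integral>x. indicator A x * g x \<partial>M)" for C D
      using i(1) assms(3) ind by (subst Bochner_Integration.integral_add) simp_all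
    then show ?thesis unfolding a(1) ..
  qed
  also have "\<dots> \<le> (\<integral>x. indicator A x * g x powr p \<partial>M)"
  proof (rule integral_mono_AE)
    show "AE x in M. indicator A x * (a powr p - p * a powr (p - 1) * a)
        + p * a powr (p - 1) * (indicator A x * g x) \<le> indicator A x * g x powr p"
      using assms(6)
    proof eventually_elim
      case (elim x)
      then show ?case
        using powr_above_tangent[OF assms(2) a(2) elim] by (simp add: indicator_def algebra_simps)
    qed
  qed (use i assms(3) ind in auto)
  finally show ?thesis .
qed

lemma norm_integral_powr_le:
  fixes f :: "'b \<Rightarrow> 'a::euclidean_space"
  assumes "prob_space M" "1 < p" "integrable M f"
  shows "ennreal (norm (\<integral>x. f x \<partial>M) powr p) \<le> (\<integral>\<^sup>+x. ennreal (norm (f x) powr p) \<partial>M)"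
proof (cases "integrable M (\<lambda>x. norm (f x) powr p)")
  case True
  interpret prob_space M by fact
  have "norm (\<integral>x. f x \<partial>M) powr p \<le> (\<integral>x. norm (f x) \<partial>M) powr p"
    using assms by (intro powr_mono2) auto
  also have "\<dots> = measure M (space M) * (\<integral>x. norm (f x) \<partial>M) powr p" by (simp add: prob_space)
  also have "\<dots> \<le> (\<integral>x. indicator (space M) x * norm (f x) powr p \<partial>M)"
    using assms True
    by (intro powr_mean_le) (auto simp: prob_space finite_measure_axioms intro!: Bochner_Integration.integral_cong)
  also have "\<dots> = (\<integral>x. norm (f x) powr p \<partial>M)" by (intro Bochner_Integration.integral_cong) auto
  finally show ?thesis using True by (simp add: nn_integral_eq_integral ennreal_leI)
next
  case False
  then have "(\<integral>\<^sup>+x. ennreal (norm (f x) powr p) \<partial>M) = \<infinity>"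
    using assms by (auto simp: integrable_iff_bounded less_top[symmetric])
  then show ?thesis by simp
qed

section \<open>Comparison of the multi-marginal cost with the Wasserstein cost\<close>

lemma graph_coupling:
  fixes T :: "'a::euclidean_space \<Rightarrow> 'a"
  assumes "sets \<mu> = sets borel" "T \<in> borel_measurable borel"
  shows "distr \<mu> (borel \<Otimes>\<^sub>M borel) (\<lambda>x. (x, T x)) \<in> couplings \<mu> (distr \<mu> borel T)"
proof -
  have [measurable_cong]: "sets \<mu> = sets borel" by fact
  have [measurable]: "T \<in> borel_measurable borel" by fact
  have "distr \<mu> borel (\<lambda>x. x) = \<mu>" using distr_id2[OF assms(1)[symmetric]] by simp
  then show ?thesis unfolding couplings_def by (simp add: distr_distr comp_def)
qed

text \<open>
  A coupling of two measures on \<open>\<Omega>\<close> lives on \<open>\<Omega> \<times> \<Omega>\<close>, where the closed form \<open>cmm_cost_eq\<close> applies.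
\<close>

lemma couplings_AE:
  fixes \<mu> \<nu> :: "'a::euclidean_space measure"
  assumes "\<gamma> \<in> couplings \<mu> \<nu>" "\<mu> \<in> prob_on \<Omega>" "\<nu> \<in> prob_on \<Omega>" "\<Omega> \<in> sets borel"
  shows "AE z in \<gamma>. fst z \<in> \<Omega> \<and> snd z \<in> \<Omega>"
proof -
  have [measurable_cong]: "sets \<gamma> = sets (borel \<Otimes>\<^sub>M borel)" using assms by (simp add: couplings_def)
  have [measurable]: "\<Omega> \<in> sets borel" by fact
  have "AE x in distr \<gamma> borel fst. x \<in> \<Omega>" "AE x in distr \<gamma> borel snd. x \<in> \<Omega>"
  proof -
    have "distr \<gamma> borel fst = \<mu>" "distr \<gamma> borel snd = \<nu>" using assms(1) by (auto simp: couplings_def)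
    then show "AE x in distr \<gamma> borel fst. x \<in> \<Omega>" "AE x in distr \<gamma> borel snd. x \<in> \<Omega>"
      using prob_onD(4)[OF assms(2,4)] prob_onD(4)[OF assms(3,4)] by (simp_all only:)
  qed
  then have "AE z in \<gamma>. fst z \<in> \<Omega>" "AE z in \<gamma>. snd z \<in> \<Omega>" by (simp_all add: AE_distr_iff)
  then show ?thesis by auto
qed

lemma coupling_cmm_cost:
  fixes \<mu> \<nu> :: "'a::euclidean_space measure"
  assumes "\<gamma> \<in> couplings \<mu> \<nu>" "\<mu> \<in> prob_on \<Omega>" "\<nu> \<in> prob_on \<Omega>" "compact \<Omega>" "convex \<Omega>"
    "1 < p" "0 \<le> t" "t \<le> 1"
  shows "(\<integral>\<^sup>+(x1, x2). ennreal (cmm_cost \<Omega> p t x1 x2) \<partial>\<gamma>)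
    = (\<integral>\<^sup>+(x1, x2). ennreal (geodesic_const p t * norm (x1 - x2) powr p) \<partial>\<gamma>)"
proof (rule nn_integral_cong_AE)
  have "\<Omega> \<in> sets borel" using assms(4) by (simp add: borel_compact)
  from couplings_AE[OF assms(1-3) this]
  show "AE z in \<gamma>. (case z of (x1, x2) \<Rightarrow> ennreal (cmm_cost \<Omega> p t x1 x2))
      = (case z of (x1, x2) \<Rightarrow> ennreal (geodesic_const p t * norm (x1 - x2) powr p))"
    by eventually_elim (auto simp: cmm_cost_eq assms)
qed

lemma CMM_le_map:
  fixes \<mu> :: "'a::euclidean_space measure"
  assumes "\<mu> \<in> prob_on \<Omega>" "distr \<mu> borel w \<in> prob_on \<Omega>" "w \<in> borel_measurable borel"
    "compact \<Omega>" "convex \<Omega>" "1 < p" "0 \<le> t" "t \<le> 1"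
  shows "CMM \<Omega> p t \<mu> (distr \<mu> borel w) \<le> (\<integral>\<^sup>+x. ennreal (geodesic_const p t * norm (x - w x) powr p) \<partial>\<mu>)"
proof -
  let ?\<gamma> = "distr \<mu> (borel \<Otimes>\<^sub>M borel) (\<lambda>x. (x, w x))"
  have [measurable_cong]: "sets \<mu> = sets borel" using assms(1) by (rule prob_onD)
  have [measurable]: "w \<in> borel_measurable borel" by fact
  have c: "?\<gamma> \<in> couplings \<mu> (distr \<mu> borel w)" by (intro graph_coupling prob_onD[OF assms(1)] assms)
  have "CMM \<Omega> p t \<mu> (distr \<mu> borel w) \<le> (\<integral>\<^sup>+(x1, x2). ennreal (cmm_cost \<Omega> p t x1 x2) \<partial>?\<gamma>)"
    unfolding CMM_def by (rule INF_lower[OF c])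
  also have "\<dots> = (\<integral>\<^sup>+(x1, x2). ennreal (geodesic_const p t * norm (x1 - x2) powr p) \<partial>?\<gamma>)"
    by (rule coupling_cmm_cost[OF c]) (use assms in auto)
  also have "\<dots> = (\<integral>\<^sup>+x. ennreal (geodesic_const p t * norm (x - w x) powr p) \<partial>\<mu>)"
    by (subst nn_integral_distr) auto
  finally show ?thesis .
qed

lemma CMM_ge_wasserstein:
  fixes \<mu> \<nu> :: "'a::euclidean_space measure"
  assumes "\<mu> \<in> prob_on \<Omega>" "\<nu> \<in> prob_on \<Omega>" "compact \<Omega>" "convex \<Omega>"
    "1 < p" "0 \<le> t" "t \<le> 1"
  shows "ennreal (geodesic_const p t) * wasserstein_pow p \<mu> \<nu> \<le> CMM \<Omega> p t \<mu> \<nu>"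
  unfolding CMM_def
proof (rule INF_greatest)
  fix \<gamma> assume g: "\<gamma> \<in> couplings \<mu> \<nu>"
  have [measurable_cong]: "sets \<gamma> = sets (borel \<Otimes>\<^sub>M borel)" using g by (simp add: couplings_def)
  have "(\<lambda>z. ennreal (norm (fst z - snd z) powr p)) \<in> borel_measurable \<gamma>" by measurable
  note m = this[unfolded case_prod_beta[symmetric]]
  have "ennreal (geodesic_const p t) * wasserstein_pow p \<mu> \<nu>
      \<le> ennreal (geodesic_const p t) * (\<integral>\<^sup>+(x, y). ennreal (norm (x - y) powr p) \<partial>\<gamma>)"
    unfolding wasserstein_pow_def by (intro mult_left_mono INF_lower g) auto
  also have "\<dots> = (\<integral>\<^sup>+(x1, x2). ennreal (geodesic_const p t * norm (x1 - x2) powr p) \<partial>\<gamma>)"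
    using geodesic_const_nonneg[of t p] assms
    by (subst nn_integral_cmult[symmetric])
      (auto simp: case_prod_beta ennreal_mult intro!: nn_integral_cong)
  also have "\<dots> = (\<integral>\<^sup>+(x1, x2). ennreal (cmm_cost \<Omega> p t x1 x2) \<partial>\<gamma>)"
    by (rule coupling_cmm_cost[symmetric, OF g]) (use assms in auto)
  finally show "ennreal (geodesic_const p t) * wasserstein_pow p \<mu> \<nu>
      \<le> (\<integral>\<^sup>+(x1, x2). ennreal (cmm_cost \<Omega> p t x1 x2) \<partial>\<gamma>)" .
qed

section \<open>The lower bound: averaging a pair of kernels\<close>

text \<open>
  The second marginal of a disintegrated coupling is the image of the first one under the kernel.
  This puts two consecutive couplings into the monad of probability kernels, where they compose.
\<close>

lemma disintegration_bind:
  fixes \<mu> \<nu> :: "'a::euclidean_space measure"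
  assumes "\<gamma> \<in> couplings \<mu> \<nu>" "disintegrates \<gamma> \<mu> \<kappa>"
  shows "\<mu> \<bind> \<kappa> = \<nu>"
proof (rule measure_eqI)
  have sg[measurable_cong]: "sets \<gamma> = sets (borel \<Otimes>\<^sub>M borel)" using assms by (simp add: couplings_def)
  have mu: "\<mu> = distr \<gamma> borel fst" and nu: "\<nu> = distr \<gamma> borel snd"
    using assms by (auto simp: couplings_def)
  have sm: "sets \<mu> = sets borel" "space \<mu> = UNIV" by (simp_all add: mu)
  have k: "\<kappa> \<in> borel \<rightarrow>\<^sub>M prob_algebra borel" using assms(2) by (simp add: disintegrates_def)
  have k': "\<kappa> \<in> \<mu> \<rightarrow>\<^sub>M subprob_algebra borel"
    using measurable_prob_algebraD[OF k] by (simp add: sm cong: measurable_cong_sets)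
  have sk: "sets (\<kappa> x) = sets borel" for x
    using measurable_space[OF k, of x] by (simp add: space_prob_algebra)
  show sb: "sets (\<mu> \<bind> \<kappa>) = sets \<nu>" using sm sk by (subst sets_bind[where N=borel]) (auto simp: nu)
  fix B assume "B \<in> sets (\<mu> \<bind> \<kappa>)"
  then have B[measurable]: "B \<in> sets borel" unfolding sb by (simp add: nu)
  have "emeasure (\<mu> \<bind> \<kappa>) B = (\<integral>\<^sup>+x. emeasure (\<kappa> x) B \<partial>\<mu>)"
    by (rule emeasure_bind[OF _ k' B]) (simp add: sm)
  also have "\<dots> = (\<integral>\<^sup>+x. (\<integral>\<^sup>+y. indicator (UNIV \<times> B) (x, y) \<partial>\<kappa> x) \<partial>\<mu>)"
    using sk by (intro nn_integral_cong) (simp add: indicator_times)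
  also have "\<dots> = emeasure \<gamma> (UNIV \<times> B)"
    using assms(2) by (simp add: disintegrates_def)
  also have "\<dots> = emeasure \<nu> B"
    unfolding nu by (subst emeasure_distr)
      (auto simp: sets_eq_imp_space_eq[OF sg] space_pair_measure intro!: arg_cong[where f="emeasure \<gamma>"])
  finally show "emeasure (\<mu> \<bind> \<kappa>) B = emeasure \<nu> B" .
qed

lemma kernel_facts:
  assumes "\<kappa> \<in> borel \<rightarrow>\<^sub>M prob_algebra borel"
  shows "prob_space (\<kappa> x)" "sets (\<kappa> x) = sets borel" "space (\<kappa> x) = UNIV"
    "\<kappa> \<in> borel \<rightarrow>\<^sub>M subprob_algebra borel"
proof -
  show "prob_space (\<kappa> x)" and 1: "sets (\<kappa> x) = sets borel"
    using measurable_space[OF assms, of x] by (auto simp: space_prob_algebra)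
  show "space (\<kappa> x) = UNIV" using sets_eq_imp_space_eq[OF 1] by simp
  show "\<kappa> \<in> borel \<rightarrow>\<^sub>M subprob_algebra borel" using assms by (rule measurable_prob_algebraD)
qed

text \<open>
  An integrand that is bounded on a set of full measure may be cut off outside of it, which reduces
  the claim to a globally bounded integrand.
\<close>

lemma integral_bind_AE_bounded:
  fixes f :: "'a::euclidean_space \<Rightarrow> real"
  assumes M: "prob_space M" "sets M = sets borel"
    and k: "\<kappa> \<in> borel \<rightarrow>\<^sub>M prob_algebra borel"
    and AE: "AE z in M. AE y in \<kappa> z. y \<in> \<Omega>" and \<Omega>: "\<Omega> \<in> sets borel"
    and f[measurable]: "f \<in> borel_measurable borel" and bdd: "\<And>y. y \<in> \<Omega> \<Longrightarrow> \<bar>f y\<bar> \<le> B"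
  shows "(\<integral>y. f y \<partial>(M \<bind> \<kappa>)) = (\<integral>z. (\<integral>y. f y \<partial>\<kappa> z) \<partial>M)"
proof -
  interpret prob_space M by fact
  have [measurable]: "\<Omega> \<in> sets borel" by fact
  have sp: "space M = UNIV" using sets_eq_imp_space_eq[OF M(2)] by simp
  note k' = kernel_facts[OF k]
  have kM: "\<kappa> \<in> M \<rightarrow>\<^sub>M subprob_algebra borel" using k'(4) M(2) by (simp cong: measurable_cong_sets)
  define g where "g y = indicator \<Omega> y * f y" for y
  have [measurable]: "g \<in> borel_measurable borel" unfolding g_def by measurable
  have [simp]: "sets (M \<bind> \<kappa>) = sets borel" using k' sp by (subst sets_bind[where N=borel]) auto
  have "AE y in M \<bind> \<kappa>. y \<in> \<Omega>" using AE by (subst AE_bind[OF kM]) auto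
  then have "(\<integral>y. f y \<partial>(M \<bind> \<kappa>)) = (\<integral>y. g y \<partial>(M \<bind> \<kappa>))"
    by (intro integral_cong_AE) (auto simp: g_def cong: measurable_cong_sets elim!: eventually_mono)
  also have "\<dots> = (\<integral>z. (\<integral>y. g y \<partial>\<kappa> z) \<partial>M)"
  proof (rule integral_bind[OF _ _ kM])
    show "finite_measure M" by unfold_locales
    show "AE x in M. emeasure (\<kappa> x) (space (\<kappa> x)) \<le> ennreal 1"
      using prob_space.emeasure_space_1[OF k'(1)] by simp
    show "\<bar>g y\<bar> \<le> \<bar>B\<bar>" for y using bdd[of y] by (auto simp: g_def indicator_def)
  qed simp
  also have "\<dots> = (\<integral>z. (\<integral>y. f y \<partial>\<kappa> z) \<partial>M)"
  proof (rule integral_cong_AE)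
    have m: "(\<lambda>z. \<integral>y. h y \<partial>\<kappa> z) \<in> borel_measurable M" if "h \<in> borel_measurable borel" for h :: "'a \<Rightarrow> real"
      using measurable_compose[OF kM integral_measurable_subprob_algebra[OF that]] .
    show "(\<lambda>z. \<integral>y. g y \<partial>\<kappa> z) \<in> borel_measurable M" by (rule m) simp
    show "(\<lambda>z. \<integral>y. f y \<partial>\<kappa> z) \<in> borel_measurable M" by (rule m) simp
    show "AE z in M. (\<integral>y. g y \<partial>\<kappa> z) = (\<integral>y. f y \<partial>\<kappa> z)"
      using AE
    proof eventually_elim
      case (elim z)
      then show ?case
        by (intro integral_cong_AE)
          (auto simp: g_def k' cong: measurable_cong_sets elim!: eventually_mono)
    qed
  qed
  finally show ?thesis .
qed

text \<open>
  The barycenter of a mixture is the mean of the barycenters, checked coordinate by coordinate.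
\<close>

lemma barycenter_bind:
  fixes M :: "'a::euclidean_space measure" and \<kappa> :: "'a \<Rightarrow> 'a measure"
  assumes M: "prob_space M" "sets M = sets borel"
    and k: "\<kappa> \<in> borel \<rightarrow>\<^sub>M prob_algebra borel"
    and AE: "AE z in M. AE y in \<kappa> z. y \<in> \<Omega>" and \<Omega>: "compact \<Omega>" "convex \<Omega>"
  shows "(\<integral>y. y \<partial>(M \<bind> \<kappa>)) = (\<integral>z. (\<integral>y. y \<partial>\<kappa> z) \<partial>M)"
    and "integrable M (\<lambda>z. \<integral>y. y \<partial>\<kappa> z)"
proof -
  interpret prob_space M by fact
  have [measurable]: "\<Omega> \<in> sets borel" using \<Omega>(1) by (simp add: borel_compact)
  have sp: "space M = UNIV" using sets_eq_imp_space_eq[OF M(2)] by simp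
  note k' = kernel_facts[OF k]
  have kM: "\<kappa> \<in> M \<rightarrow>\<^sub>M subprob_algebra borel" using k'(4) M(2) by (simp cong: measurable_cong_sets)
  have [simp]: "sets (M \<bind> \<kappa>) = sets borel" using k' sp by (subst sets_bind[where N=borel]) auto
  have pB: "prob_space (M \<bind> \<kappa>)" using k'(1) by (intro prob_space_bind[OF _ kM]) auto
  have "AE y in M \<bind> \<kappa>. y \<in> \<Omega>" using AE by (subst AE_bind[OF kM]) auto
  then have i1: "integrable (M \<bind> \<kappa>) (\<lambda>y. y)"
    by (intro integrable_AE_compact[OF prob_space.finite_measure[OF pB] _ _ \<Omega>(1)])
      (auto cong: measurable_cong_sets)
  have AEb: "AE z in M. (\<integral>y. y \<partial>\<kappa> z) \<in> \<Omega>"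
    using AE
  proof eventually_elim
    case (elim z)
    then show ?case
      using k' \<Omega> by (intro integral_mem_compact_convex) (auto cong: measurable_cong_sets)
  qed
  have mb: "(\<lambda>z. \<integral>y. y \<partial>\<kappa> z) \<in> borel_measurable M"
    using measurable_compose[OF kM integral_measurable_subprob_algebra[of "\<lambda>y. y"]] by simp
  show i2: "integrable M (\<lambda>z. \<integral>y. y \<partial>\<kappa> z)"
    using mb AEb \<Omega>(1) by (intro integrable_AE_compact) unfold_locales
  obtain B where B: "\<And>y. y \<in> \<Omega> \<Longrightarrow> norm y \<le> B"
    using compact_imp_bounded[OF \<Omega>(1)] by (auto simp: bounded_iff)
  show "(\<integral>y. y \<partial>(M \<bind> \<kappa>)) = (\<integral>z. (\<integral>y. y \<partial>\<kappa> z) \<partial>M)"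
  proof (rule euclidean_eqI)
    fix e :: 'a assume "e \<in> Basis"
    have "(\<integral>y. y \<partial>(M \<bind> \<kappa>)) \<bullet> e = (\<integral>y. y \<bullet> e \<partial>(M \<bind> \<kappa>))" using i1 by simp
    also have "\<dots> = (\<integral>z. (\<integral>y. y \<bullet> e \<partial>\<kappa> z) \<partial>M)"
    proof (rule integral_bind_AE_bounded[OF M k AE])
      show "\<bar>y \<bullet> e\<bar> \<le> B" if "y \<in> \<Omega>" for y
        using Basis_le_norm[OF \<open>e \<in> Basis\<close>, of y] B[OF that] by simp
    qed auto
    also have "\<dots> = (\<integral>z. (\<integral>y. y \<partial>\<kappa> z) \<bullet> e \<partial>M)"
    proof (rule integral_cong_AE)
      show "(\<lambda>z. \<integral>y. y \<bullet> e \<partial>\<kappa> z) \<in> borel_measurable M"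
        using measurable_compose[OF kM integral_measurable_subprob_algebra[of "\<lambda>y. y \<bullet> e"]] by simp
      show "(\<lambda>z. (\<integral>y. y \<partial>\<kappa> z) \<bullet> e) \<in> borel_measurable M" using mb by measurable
      show "AE z in M. (\<integral>y. y \<bullet> e \<partial>\<kappa> z) = (\<integral>y. y \<partial>\<kappa> z) \<bullet> e"
        using AE
      proof eventually_elim
        case (elim z)
        then have "integrable (\<kappa> z) (\<lambda>y. y)"
          using k' \<Omega>(1)
          by (intro integrable_AE_compact[OF prob_space.finite_measure]) (auto cong: measurable_cong_sets)
        then show ?case by simp
      qed
    qed
    also have "\<dots> = (\<integral>z. (\<integral>y. y \<partial>\<kappa> z) \<partial>M) \<bullet> e" using i2 by simp
    finally show "(\<integral>y. y \<partial>(M \<bind> \<kappa>)) \<bullet> e = (\<integral>z. (\<integral>y. y \<partial>\<kappa> z) \<partial>M) \<bullet> e" .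
  qed
qed

text \<open>
  Replacing each \<open>K x\<close> by its barycenter contracts in the convex order; this is the easy half of
  Strassen's theorem.
\<close>

lemma barycenters_convex_order:
  fixes \<mu> \<mu>' :: "'a::euclidean_space measure"
  assumes \<mu>: "\<mu> \<in> prob_on \<Omega>" "\<mu>' \<in> prob_on \<Omega>" and K: "K \<in> borel \<rightarrow>\<^sub>M prob_algebra borel"
    and b: "\<mu> \<bind> K = \<mu>'" and \<Omega>: "compact \<Omega>" "convex \<Omega>"
  defines "w \<equiv> \<lambda>x. \<integral>y. y \<partial>K x"
  shows "w \<in> borel_measurable borel" "distr \<mu> borel w \<in> prob_on \<Omega>" "distr \<mu> borel w \<le>\<^sub>c\<^sub>x \<mu>'"
    "AE x in \<mu>. AE y in K x. y \<in> \<Omega>"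
proof -
  have \<Omega>b[measurable]: "\<Omega> \<in> sets borel" using \<Omega>(1) by (simp add: borel_compact)
  note m = prob_onD[OF \<mu>(1)] and m' = prob_onD[OF \<mu>(2)] and k = kernel_facts[OF K]
  interpret prob_space \<mu> by (rule m)
  have [measurable_cong]: "sets \<mu> = sets borel" by (rule m)
  have kM: "K \<in> \<mu> \<rightarrow>\<^sub>M subprob_algebra borel" using k(4) m(2) by (simp cong: measurable_cong_sets)
  show w[measurable]: "w \<in> borel_measurable borel"
    unfolding w_def using measurable_compose[OF k(4) integral_measurable_subprob_algebra[of "\<lambda>y. y"]] by simp
  have "AE y in \<mu> \<bind> K. y \<in> \<Omega>" unfolding b by (rule m'(4)[OF \<Omega>b])
  then show AE: "AE x in \<mu>. AE y in K x. y \<in> \<Omega>" by (subst (asm) AE_bind[OF kM]) auto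
  have wO: "AE x in \<mu>. w x \<in> \<Omega>"
    using AE unfolding w_def
    by eventually_elim (use k \<Omega> in \<open>auto intro!: integral_mem_compact_convex cong: measurable_cong_sets\<close>)
  then show "distr \<mu> borel w \<in> prob_on \<Omega>"
    by (intro prob_onI prob_space_distr) (auto simp: AE_distr_iff)
  show "distr \<mu> borel w \<le>\<^sub>c\<^sub>x \<mu>'"
    unfolding convex_order_def
  proof (intro allI impI)
    fix \<phi> :: "'a \<Rightarrow> real" assume \<phi>: "convex_on UNIV \<phi>"
    note [measurable] = convex_bounded_on_compact(1)[OF \<phi> \<Omega>(1)]
    obtain B where B: "\<And>y. y \<in> \<Omega> \<Longrightarrow> \<bar>\<phi> y\<bar> \<le> B"
      using convex_bounded_on_compact(2)[OF \<phi> \<Omega>(1)] by blast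
    have J: "AE x in \<mu>. \<phi> (w x) \<le> (\<integral>y. \<phi> y \<partial>K x) \<and> \<bar>\<integral>y. \<phi> y \<partial>K x\<bar> \<le> B"
      using AE
    proof eventually_elim
      case (elim x)
      interpret K: prob_space "K x" by (rule k)
      have "\<phi> (w x) \<le> (\<integral>y. \<phi> y \<partial>K x)"
        unfolding w_def using elim k \<Omega>
        by (intro jensen_convex_compact[OF \<phi>]) (auto cong: measurable_cong_sets)
      moreover have "\<bar>\<integral>y. \<phi> y \<partial>K x\<bar> \<le> (\<integral>y. B \<partial>K x)"
      proof -
        have "AE y in K x. norm (\<phi> y) \<le> B" using elim B by (auto elim!: eventually_mono)
        moreover from this have "integrable (K x) \<phi>"
          by (rule K.integrable_const_bound) (simp add: k cong: measurable_cong_sets)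
        ultimately have "(\<integral>y. norm (\<phi> y) \<partial>K x) \<le> (\<integral>y. B \<partial>K x)"
          by (intro integral_mono_AE) auto
        then show ?thesis by (intro order_trans[OF integral_abs_bound]) simp
      qed
      ultimately show ?case by (simp add: K.prob_space)
    qed
    have mK: "(\<lambda>x. \<integral>y. \<phi> y \<partial>K x) \<in> borel_measurable \<mu>"
      using measurable_compose[OF kM integral_measurable_subprob_algebra[of \<phi>]] by simp
    have "(\<integral>x. \<phi> x \<partial>distr \<mu> borel w) = (\<integral>x. \<phi> (w x) \<partial>\<mu>)" by (rule integral_distr) auto
    also have "\<dots> \<le> (\<integral>x. (\<integral>y. \<phi> y \<partial>K x) \<partial>\<mu>)"
    proof (rule integral_mono_AE)
      show "integrable \<mu> (\<lambda>x. \<phi> (w x))"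
        using wO B by (intro integrable_const_bound[of _ B]) (auto elim!: eventually_mono)
      show "integrable \<mu> (\<lambda>x. \<integral>y. \<phi> y \<partial>K x)"
        using J mK by (intro integrable_const_bound[of _ B]) (auto elim!: eventually_mono)
      show "AE x in \<mu>. \<phi> (w x) \<le> (\<integral>y. \<phi> y \<partial>K x)" using J by eventually_elim simp
    qed
    also have "\<dots> = (\<integral>x. \<phi> x \<partial>\<mu>')"
      unfolding b[symmetric] by (rule integral_bind_AE_bounded[symmetric, OF m(1,2) K AE \<Omega>b]) (use B in auto)
    finally show "(\<integral>x. \<phi> x \<partial>distr \<mu> borel w) \<le> (\<integral>x. \<phi> x \<partial>\<mu>')" .
  qed
qed

text \<open>
  The lower bound described at the beginning: \<open>\<eta>\<close> is the law under \<open>\<mu>1\<close> of the barycenters of the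
  composed kernel.
\<close>

lemma CMM_le_kernel_costs:
  fixes \<mu>1 \<mu>2 \<nu> :: "'a::euclidean_space measure"
  assumes \<Omega>: "compact \<Omega>" "convex \<Omega>" and p: "1 < p" and t: "0 \<le> t" "t \<le> 1"
    and \<mu>: "\<mu>1 \<in> prob_on \<Omega>" "\<nu> \<in> prob_on \<Omega>" "\<mu>2 \<in> prob_on \<Omega>"
    and k1: "\<kappa>1 \<in> borel \<rightarrow>\<^sub>M prob_algebra borel" "\<mu>1 \<bind> \<kappa>1 = \<nu>"
    and k2: "\<kappa>2 \<in> borel \<rightarrow>\<^sub>M prob_algebra borel" "\<nu> \<bind> \<kappa>2 = \<mu>2"
  obtains \<eta> where "\<eta> \<in> prob_on \<Omega>" "\<eta> \<le>\<^sub>c\<^sub>x \<mu>2"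
    "CMM \<Omega> p t \<mu>1 \<eta> \<le> ennreal t * (\<integral>\<^sup>+z. ennreal (norm (z - (\<integral>y. y \<partial>\<kappa>2 z)) powr p) \<partial>\<nu>)
      + ennreal (1 - t) * (\<integral>\<^sup>+x. ennreal (norm (x - (\<integral>z. z \<partial>\<kappa>1 x)) powr p) \<partial>\<mu>1)"
proof -
  have \<Omega>b[measurable]: "\<Omega> \<in> sets borel" using \<Omega>(1) by (simp add: borel_compact)
  note m1 = prob_onD[OF \<mu>(1)] and mn = prob_onD[OF \<mu>(2)] and m2 = prob_onD[OF \<mu>(3)]
  note K1 = kernel_facts[OF k1(1)] and K2 = kernel_facts[OF k2(1)]
  have [measurable_cong]: "sets \<mu>1 = sets borel" "sets \<nu> = sets borel" by (rule m1 mn)+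
  define K where "K x = \<kappa>1 x \<bind> \<kappa>2" for x
  have K: "K \<in> borel \<rightarrow>\<^sub>M prob_algebra borel"
    unfolding K_def using k1(1) k2(1) by (rule measurable_bind_prob_space)
  have k1M: "\<kappa>1 \<in> \<mu>1 \<rightarrow>\<^sub>M subprob_algebra borel" using K1(4) m1(2) by (simp cong: measurable_cong_sets)
  have k2M: "\<kappa>2 \<in> \<nu> \<rightarrow>\<^sub>M subprob_algebra borel" using K2(4) mn(2) by (simp cong: measurable_cong_sets)
  have b: "\<mu>1 \<bind> K = \<mu>2"
    unfolding K_def k2(2)[symmetric] k1(2)[symmetric] by (rule bind_assoc[symmetric, OF k1M K2(4)])
  define w where "w x = (\<integral>y. y \<partial>K x)" for x
  define b1 where "b1 x = (\<integral>z. z \<partial>\<kappa>1 x)" for x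
  define b2 where "b2 z = (\<integral>y. y \<partial>\<kappa>2 z)" for z
  note BC = barycenters_convex_order[OF \<mu>(1,3) K b \<Omega>, folded w_def]
  have [measurable]: "w \<in> borel_measurable borel" by (rule BC)
  have mb[measurable]: "b1 \<in> borel_measurable borel" "b2 \<in> borel_measurable borel"
    unfolding b1_def b2_def
    using measurable_compose[OF K1(4) integral_measurable_subprob_algebra[of "\<lambda>y. y"]]
      measurable_compose[OF K2(4) integral_measurable_subprob_algebra[of "\<lambda>y. y"]] by simp_all
  have AE1: "AE x in \<mu>1. AE z in \<kappa>1 x. z \<in> \<Omega>"
    using mn(4)[OF \<Omega>b] unfolding k1(2)[symmetric] by (subst (asm) AE_bind[OF k1M]) auto
  have eq: "AE z in \<kappa>1 x. AE y in \<kappa>2 z. y \<in> \<Omega>" if "AE y in K x. y \<in> \<Omega>" for x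
  proof -
    have "\<kappa>2 \<in> \<kappa>1 x \<rightarrow>\<^sub>M subprob_algebra borel" using K2(4) K1(2) by (simp cong: measurable_cong_sets)
    from AE_bind[OF this, of "\<lambda>y. y \<in> \<Omega>"] show ?thesis using that unfolding K_def by simp
  qed
  \<comment> \<open>\<open>b1 x - w x\<close> is the mean of \<open>z - b2 z\<close> under \<open>\<kappa>1 x\<close>.\<close>
  have step: "AE x in \<mu>1. ennreal (norm (w x - b1 x) powr p) \<le> (\<integral>\<^sup>+z. ennreal (norm (z - b2 z) powr p) \<partial>\<kappa>1 x)"
    using AE1 BC(4)
  proof eventually_elim
    case (elim x)
    note bb = barycenter_bind[OF K1(1,2) k2(1) eq[OF elim(2)] \<Omega>, folded b2_def]
    have i: "integrable (\<kappa>1 x) (\<lambda>z. z)"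
      using elim(1) K1 \<Omega>(1)
      by (intro integrable_AE_compact[OF prob_space.finite_measure]) (auto cong: measurable_cong_sets)
    have "b1 x - w x = (\<integral>z. z - b2 z \<partial>\<kappa>1 x)"
      unfolding w_def b1_def K_def bb(1) using i bb(2) by simp
    then have "norm (w x - b1 x) = norm (\<integral>z. z - b2 z \<partial>\<kappa>1 x)" by (metis norm_minus_commute)
    then show ?case
      using i bb(2) K1(1) p by (simp only:) (intro norm_integral_powr_le, auto)
  qed
  have "CMM \<Omega> p t \<mu>1 (distr \<mu>1 borel w) \<le> (\<integral>\<^sup>+x. ennreal (geodesic_const p t * norm (x - w x) powr p) \<partial>\<mu>1)"
    by (intro CMM_le_map \<mu> BC \<Omega> p t)
  also have "\<dots> \<le> (\<integral>\<^sup>+x. ennreal t * (\<integral>\<^sup>+z. ennreal (norm (z - b2 z) powr p) \<partial>\<kappa>1 x)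
        + ennreal (1 - t) * ennreal (norm (x - b1 x) powr p) \<partial>\<mu>1)"
  proof (rule nn_integral_mono_AE)
    show "AE x in \<mu>1. ennreal (geodesic_const p t * norm (x - w x) powr p)
      \<le> ennreal t * (\<integral>\<^sup>+z. ennreal (norm (z - b2 z) powr p) \<partial>\<kappa>1 x)
        + ennreal (1 - t) * ennreal (norm (x - b1 x) powr p)"
      using step
    proof eventually_elim
      case (elim x)
      have "ennreal (geodesic_const p t * norm (x - w x) powr p)
          \<le> ennreal (t * norm (w x - b1 x) powr p + (1 - t) * norm (b1 x - x) powr p)"
        by (intro ennreal_leI geodesic_const_le p t)
      also have "\<dots> = ennreal t * ennreal (norm (w x - b1 x) powr p)
          + ennreal (1 - t) * ennreal (norm (x - b1 x) powr p)"
        using t by (subst ennreal_plus) (simp_all add: ennreal_mult norm_minus_commute[of x])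
      also have "\<dots> \<le> ennreal t * (\<integral>\<^sup>+z. ennreal (norm (z - b2 z) powr p) \<partial>\<kappa>1 x)
          + ennreal (1 - t) * ennreal (norm (x - b1 x) powr p)"
        using elim by (intro add_right_mono mult_left_mono) auto
      finally show ?case .
    qed
  qed
  also have "\<dots> = ennreal t * (\<integral>\<^sup>+x. (\<integral>\<^sup>+z. ennreal (norm (z - b2 z) powr p) \<partial>\<kappa>1 x) \<partial>\<mu>1)
      + ennreal (1 - t) * (\<integral>\<^sup>+x. ennreal (norm (x - b1 x) powr p) \<partial>\<mu>1)"
  proof -
    have f: "(\<lambda>z. ennreal (norm (z - b2 z) powr p)) \<in> borel_measurable borel" by measurable
    have "(\<lambda>x. \<integral>\<^sup>+z. ennreal (norm (z - b2 z) powr p) \<partial>\<kappa>1 x) \<in> borel_measurable \<mu>1"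
      by (rule measurable_compose[OF k1M nn_integral_measurable_subprob_algebra[OF f]])
    then show ?thesis by (subst nn_integral_add) (auto simp: nn_integral_cmult)
  qed
  also have "(\<integral>\<^sup>+x. (\<integral>\<^sup>+z. ennreal (norm (z - b2 z) powr p) \<partial>\<kappa>1 x) \<partial>\<mu>1) = (\<integral>\<^sup>+z. ennreal (norm (z - b2 z) powr p) \<partial>\<nu>)"
    unfolding k1(2)[symmetric] by (rule nn_integral_bind[symmetric, OF _ k1M]) measurable
  finally show thesis
    using that[OF BC(2,3)] unfolding b1_def b2_def by blast
qed

section \<open>Finite transport plans with prescribed moments\<close>

text \<open>
  Strict separation of a point from a compact convex set, for families over a finite index set that
  is not a type. The direction is given by the residual at the nearest point: moving from there
  towards another point of \<open>C\<close> cannot decrease the distance to first order.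
\<close>

lemma separation_finite_family:
  fixes C :: "('i \<Rightarrow> 'b::euclidean_space) set"
  assumes "finite I" and C: "compact C"
    and conv: "\<And>c c' u. c \<in> C \<Longrightarrow> c' \<in> C \<Longrightarrow> 0 \<le> u \<Longrightarrow> u \<le> 1 \<Longrightarrow>
       (\<lambda>i. (1 - u) *\<^sub>R c i + u *\<^sub>R c' i) \<in> C"
    and notin: "\<And>c. c \<in> C \<Longrightarrow> \<exists>i\<in>I. c i \<noteq> \<tau> i"
  obtains u where "\<And>c. c \<in> C \<Longrightarrow> (\<Sum>i\<in>I. u i \<bullet> c i) < (\<Sum>i\<in>I. u i \<bullet> \<tau> i)"
proof (cases "C = {}")
  case True
  then show ?thesis using that by auto
next
  case False
  define G where "G c = (\<Sum>i\<in>I. (norm (\<tau> i - c i))\<^sup>2)" for c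
  have "continuous_on C G" unfolding G_def
    by (intro continuous_intros continuous_on_product_then_coordinatewise[OF continuous_on_id])
  from continuous_attains_inf[OF C False this]
  obtain c0 where c0: "c0 \<in> C" "\<And>c. c \<in> C \<Longrightarrow> G c0 \<le> G c" by blast
  define u where "u i = \<tau> i - c0 i" for i
  obtain k where "k \<in> I" "c0 k \<noteq> \<tau> k" using notin[OF c0(1)] by blast
  then have Gpos: "0 < (\<Sum>i\<in>I. u i \<bullet> u i)"
    using \<open>finite I\<close> by (intro sum_pos2[of _ k]) (auto simp: u_def)
  show thesis
  proof (rule that[of u])
    fix c assume c: "c \<in> C"
    define d where "d i = c i - c0 i" for i
    define X where "X = (\<Sum>i\<in>I. u i \<bullet> d i)"
    define Y where "Y = (\<Sum>i\<in>I. d i \<bullet> d i)"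
    have Y: "Y \<ge> 0" by (simp add: Y_def sum_nonneg)
    \<comment> \<open>Compare the nearest point with the point a fraction \<open>e\<close> of the way towards \<open>c\<close>.\<close>
    have ineq: "2 * X \<le> e * Y" if e: "0 < e" "e \<le> 1" for e
    proof -
      have eq: "\<tau> i - ((1 - e) *\<^sub>R c0 i + e *\<^sub>R c i) = u i - e *\<^sub>R d i" for i
        by (simp add: u_def d_def algebra_simps)
      have "G c0 \<le> G (\<lambda>i. (1 - e) *\<^sub>R c0 i + e *\<^sub>R c i)"
        using e by (intro c0(2) conv c0(1) c) auto
      also have "\<dots> = (\<Sum>i\<in>I. u i \<bullet> u i - 2 * e * (u i \<bullet> d i) + e * e * (d i \<bullet> d i))"
        unfolding G_def eq power2_norm_eq_inner
        by (intro sum.cong refl) (simp add: algebra_simps inner_commute)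
      also have "\<dots> = G c0 - 2 * e * X + e * e * Y"
        by (simp add: G_def u_def[symmetric] power2_norm_eq_inner X_def Y_def sum.distrib
            sum_subtractf sum_distrib_left)
      finally have "e * (2 * X) \<le> e * (e * Y)" by (simp add: algebra_simps)
      then show ?thesis using e by simp
    qed
    have "X \<le> 0"
    proof (rule ccontr)
      assume "\<not> X \<le> 0"
      then have X: "X > 0" by simp
      define e where "e = min 1 (X / (Y + 1))"
      have e: "0 < e" "e \<le> 1" "e \<le> X / (Y + 1)" using X Y by (auto simp: e_def)
      have "e * Y \<le> X / (Y + 1) * Y" using e Y by (intro mult_right_mono) auto
      also have "\<dots> \<le> X" using X Y by (simp add: field_simps)
      finally show False using ineq[OF e(1,2)] X by simp
    qed
    moreover have "(\<Sum>i\<in>I. u i \<bullet> c i) = X + (\<Sum>i\<in>I. u i \<bullet> c0 i)"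
      by (simp add: X_def d_def inner_diff_right sum_subtractf)
    moreover have "(\<Sum>i\<in>I. u i \<bullet> \<tau> i) = (\<Sum>i\<in>I. u i \<bullet> u i) + (\<Sum>i\<in>I. u i \<bullet> c0 i)"
      by (simp add: u_def inner_diff_right sum_subtractf)
    ultimately show "(\<Sum>i\<in>I. u i \<bullet> c i) < (\<Sum>i\<in>I. u i \<bullet> \<tau> i)" using Gpos by simp
  qed
qed

lemma compact_product_UNIV:
  fixes S :: "'i \<Rightarrow> 'b::topological_space set"
  assumes "\<And>i. compact (S i)"
  shows "compact {x. \<forall>i. x i \<in> S i}"
proof -
  have "compactin (product_topology (\<lambda>i. euclidean) UNIV) (PiE UNIV S)"
    using assms by (subst compactin_PiE) auto
  moreover have "PiE UNIV S = {x. \<forall>i. x i \<in> S i}" by (auto simp: PiE_def)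
  ultimately show ?thesis by (simp add: euclidean_product_topology)
qed

lemma closed_sublevel_and_level_set:
  fixes f :: "'c::topological_space \<Rightarrow> real"
  assumes "continuous_on UNIV f" shows "closed {x. f x \<le> a}" "closed {x. f x = a}"
  using assms by (auto intro!: closed_Collect_le closed_Collect_eq)

lemma finite_has_maximizer:
  fixes g :: "'i \<Rightarrow> real"
  assumes "finite F" "F \<noteq> {}"
  shows "\<exists>j\<in>F. \<forall>k\<in>F. g k \<le> g j"
proof -
  have "Max (g ` F) \<in> g ` F" using assms by (intro Max_in) auto
  then obtain j where j: "j \<in> F" "Max (g ` F) = g j" by (elim imageE)
  have "g k \<le> g j" if "k \<in> F" for k
    unfolding j(2)[symmetric] using assms that by (intro Max_ge finite_imageI imageI)
  then show ?thesis using j(1) by blast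
qed

text \<open>
  Duality for a finite transport problem with rows \<open>n\<close>, columns \<open>q\<close> and a constraint on the moment of
  each row, relaxed in total by \<open>D\<close>. The dual variables are \<open>v\<close> for the moments, \<open>f\<close> for the columns
  and \<open>c\<close> for the rows. As the error is measured by a sum of norms, its dual is the largest
  norm of the vectors \<open>v\<close>, here bounded by \<open>L\<close>; this is a Lipschitz constant of the convex function
  \<open>max\<^sub>i (v\<^sub>i \<bullet> y - c\<^sub>i)\<close>.
\<close>

lemma transport_plan_duality:
  fixes b m :: "'i \<Rightarrow> 'a::euclidean_space" and n q :: "'i \<Rightarrow> real"
  assumes F: "finite F" "F \<noteq> {}" and n: "\<And>i. i \<in> F \<Longrightarrow> 0 \<le> n i" and D: "0 \<le> D"
    and dual: "\<And>v f c L. (\<And>i. i \<in> F \<Longrightarrow> norm (v i) \<le> L) \<Longrightarrow>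
        (\<And>i j. i \<in> F \<Longrightarrow> j \<in> F \<Longrightarrow> v i \<bullet> b j + f j \<le> c i) \<Longrightarrow>
        (\<Sum>i\<in>F. v i \<bullet> m i) + (\<Sum>j\<in>F. f j * q j) \<le> (\<Sum>i\<in>F. n i * c i) + D * L"
  obtains \<rho> where "\<And>i j. i \<in> F \<Longrightarrow> j \<in> F \<Longrightarrow> 0 \<le> \<rho> i j"
    "\<And>i. i \<in> F \<Longrightarrow> (\<Sum>j\<in>F. \<rho> i j) = n i" "\<And>j. j \<in> F \<Longrightarrow> (\<Sum>i\<in>F. \<rho> i j) = q j"
    "(\<Sum>i\<in>F. norm (m i - (\<Sum>j\<in>F. \<rho> i j *\<^sub>R b j))) \<le> D"
proof -
  \<comment> \<open>\<open>P\<close> holds the matrices with the right row sums, \<open>Q\<close> the admissible moment errors. Entries outside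
    the index set are fixed to \<open>0\<close> so that \<open>P\<close> and \<open>Q\<close> are compact in the product topology. A
    solution is a preimage of the family \<open>\<tau>\<close> of moments and column sums.\<close>
  define P where "P = {\<rho>::'i \<times> 'i \<Rightarrow> real.
      (\<forall>x. \<rho> x \<in> (if fst x \<in> F \<and> snd x \<in> F then {0..n (fst x)} else {0}))} \<inter>
      (\<Inter>i\<in>F. {\<rho>. (\<Sum>j\<in>F. \<rho> (i, j)) = n i})"
  define Q where "Q = {w::'i \<Rightarrow> 'a. (\<forall>i. w i \<in> (if i \<in> F then cball 0 D else {0}))} \<inter>
      {w. (\<Sum>i\<in>F. norm (w i)) \<le> D}"
  define \<Phi> where "\<Phi> = (\<lambda>(\<rho>::'i \<times> 'i \<Rightarrow> real, w::'i \<Rightarrow> 'a) i.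
      ((\<Sum>j\<in>F. \<rho> (i, j) *\<^sub>R b j) + w i, \<Sum>k\<in>F. \<rho> (k, i)))"
  define \<tau> where "\<tau> i = (m i, q i)" for i
  have "compact P" unfolding P_def
    by (intro compact_Int_closed compact_product_UNIV closed_INT ballI closed_sublevel_and_level_set
        continuous_intros continuous_on_product_then_coordinatewise[OF continuous_on_id]) auto
  moreover have "compact Q" unfolding Q_def
    by (intro compact_Int_closed compact_product_UNIV closed_sublevel_and_level_set
        continuous_intros continuous_on_product_then_coordinatewise[OF continuous_on_id]) auto
  moreover have "continuous_on (P \<times> Q) \<Phi>"
    unfolding \<Phi>_def case_prod_beta
    by (intro continuous_on_coordinatewise_then_product continuous_on_Pair continuous_on_add
        continuous_on_sum continuous_on_scaleR continuous_on_const
        continuous_on_product_then_coordinatewise[OF continuous_on_fst[OF continuous_on_id]]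
        continuous_on_product_then_coordinatewise[OF continuous_on_snd[OF continuous_on_id]])
  ultimately have comp: "compact (\<Phi> ` (P \<times> Q))"
    by (intro compact_continuous_image compact_Times)
  have Pmem: "\<rho> x \<in> (if fst x \<in> F \<and> snd x \<in> F then {0..n (fst x)} else {0})" if "\<rho> \<in> P" for \<rho> x
    using that unfolding P_def by blast
  have Pcomb: "(\<lambda>x. (1 - u) * \<rho> x + u * \<rho>' x) \<in> P"
    if "\<rho> \<in> P" "\<rho>' \<in> P" "0 \<le> u" "u \<le> 1" for \<rho> \<rho>' u
  proof -
    have "(1 - u) * \<rho> x + u * \<rho>' x \<in> (if fst x \<in> F \<and> snd x \<in> F then {0..n (fst x)} else {0})" for x
    proof (cases "fst x \<in> F \<and> snd x \<in> F")
      case True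
      then have "\<rho> x \<in> {0..n (fst x)}" "\<rho>' x \<in> {0..n (fst x)}"
        using Pmem[OF that(1), of x] Pmem[OF that(2), of x] by simp_all
      then have "(1 - u) *\<^sub>R \<rho> x + u *\<^sub>R \<rho>' x \<in> {0..n (fst x)}"
        using that by (intro convexD convex_real_interval) auto
      then show ?thesis using True by simp
    next
      case False
      then have "\<rho> x = 0" "\<rho>' x = 0"
        using Pmem[OF that(1), of x] Pmem[OF that(2), of x] by (simp_all split: if_splits)
      then show ?thesis unfolding if_not_P[OF False] by simp
    qed
    moreover have "(\<Sum>j\<in>F. (1 - u) * \<rho> (i, j) + u * \<rho>' (i, j)) = n i" if "i \<in> F" for i
    proof -
      have "(\<Sum>j\<in>F. \<rho> (i, j)) = n i" "(\<Sum>j\<in>F. \<rho>' (i, j)) = n i"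
        using \<open>\<rho> \<in> P\<close> \<open>\<rho>' \<in> P\<close> that unfolding P_def by blast+
      then show ?thesis
        by (simp add: sum.distrib sum_distrib_left[symmetric]) (simp add: algebra_simps)
    qed
    ultimately show ?thesis unfolding P_def by blast
  qed
  have Qcomb: "(\<lambda>x. (1 - u) *\<^sub>R w x + u *\<^sub>R w' x) \<in> Q"
    if "w \<in> Q" "w' \<in> Q" "0 \<le> u" "u \<le> 1" for w w' u
  proof -
    have "(1 - u) *\<^sub>R w i + u *\<^sub>R w' i \<in> (if i \<in> F then cball 0 D else {0})" for i
    proof -
      have "w i \<in> (if i \<in> F then cball 0 D else {0})" "w' i \<in> (if i \<in> F then cball 0 D else {0})"
        using that by (auto simp: Q_def)
      then show ?thesis using that by (intro convexD) (auto split: if_splits)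
    qed
    moreover have "(\<Sum>i\<in>F. norm ((1 - u) *\<^sub>R w i + u *\<^sub>R w' i)) \<le> D"
    proof -
      have "(\<Sum>i\<in>F. norm ((1 - u) *\<^sub>R w i + u *\<^sub>R w' i))
          \<le> (\<Sum>i\<in>F. (1 - u) * norm (w i) + u * norm (w' i))"
        using that by (intro sum_mono order_trans[OF norm_triangle_ineq]) simp
      also have "\<dots> = (1 - u) * (\<Sum>i\<in>F. norm (w i)) + u * (\<Sum>i\<in>F. norm (w' i))"
        by (simp add: sum.distrib sum_distrib_left)
      also have "\<dots> \<le> D"
        using that by (intro convex_bound_le) (auto simp: Q_def)
      finally show ?thesis .
    qed
    ultimately show ?thesis unfolding Q_def by blast
  qed
  have conv: "(\<lambda>i. (1 - u) *\<^sub>R c i + u *\<^sub>R c' i) \<in> \<Phi> ` (P \<times> Q)"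
    if c: "c \<in> \<Phi> ` (P \<times> Q)" "c' \<in> \<Phi> ` (P \<times> Q)" and u: "0 \<le> u" "u \<le> 1" for c c' u
  proof -
    obtain \<rho> w \<rho>' w' where e: "\<rho> \<in> P" "w \<in> Q" "c = \<Phi> (\<rho>, w)" "\<rho>' \<in> P" "w' \<in> Q" "c' = \<Phi> (\<rho>', w')"
      using c by auto
    have "(\<lambda>i. (1 - u) *\<^sub>R c i + u *\<^sub>R c' i)
        = \<Phi> (\<lambda>x. (1 - u) * \<rho> x + u * \<rho>' x, \<lambda>x. (1 - u) *\<^sub>R w x + u *\<^sub>R w' x)"
      by (simp add: e \<Phi>_def fun_eq_iff scaleR_add_right scaleR_add_left scaleR_sum_right sum.distrib
          sum_distrib_left)
    then show ?thesis using Pcomb[OF e(1,4) u] Qcomb[OF e(2,5) u] by blast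
  qed
  have "\<exists>c\<in>\<Phi> ` (P \<times> Q). \<forall>i\<in>F. c i = \<tau> i"
  proof (rule ccontr)
    assume "\<not> ?thesis"
    then have "\<And>c. c \<in> \<Phi> ` (P \<times> Q) \<Longrightarrow> \<exists>i\<in>F. c i \<noteq> \<tau> i" by blast
    from separation_finite_family[OF F(1) comp conv this]
    obtain u where u: "\<And>c. c \<in> \<Phi> ` (P \<times> Q) \<Longrightarrow> (\<Sum>i\<in>F. u i \<bullet> c i) < (\<Sum>i\<in>F. u i \<bullet> \<tau> i)"
      by blast
    define v where "v i = fst (u i)" for i
    define f where "f i = snd (u i)" for i
    \<comment> \<open>Maximize the separating functional: each row puts its mass on a best column \<open>J i\<close>, and the whole
      error \<open>D\<close> goes to a row \<open>l\<close> where \<open>v\<close> is longest.\<close>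
    have "\<exists>j\<in>F. \<forall>k\<in>F. v i \<bullet> b k + f k \<le> v i \<bullet> b j + f j" for i
      by (rule finite_has_maximizer[OF F])
    then obtain J where J: "\<And>i. J i \<in> F" "\<And>i k. k \<in> F \<Longrightarrow> v i \<bullet> b k + f k \<le> v i \<bullet> b (J i) + f (J i)"
      by metis
    define c where "c i = v i \<bullet> b (J i) + f (J i)" for i
    obtain l where l: "l \<in> F" "\<And>i. i \<in> F \<Longrightarrow> norm (v i) \<le> norm (v l)"
      using finite_has_maximizer[OF F, of "\<lambda>i. norm (v i)"] by blast
    define \<rho> where "\<rho> = (\<lambda>(i, j). if i \<in> F \<and> j = J i then n i else 0)"
    define w where "w i = (if i = l then D *\<^sub>R sgn (v l) else 0)" for i
    have "\<rho> \<in> P"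
      using F n J(1) unfolding P_def \<rho>_def by (auto simp: sum.delta)
    moreover have nw: "norm (w i) \<le> (if i = l then D else 0)" for i
      using D by (auto simp: w_def norm_sgn)
    have "w \<in> Q"
    proof -
      have "(\<Sum>i\<in>F. norm (w i)) \<le> (\<Sum>i\<in>F. if i = l then D else 0)" by (intro sum_mono nw)
      also have "\<dots> = D" using F l by simp
      finally have "(\<Sum>i\<in>F. norm (w i)) \<le> D" .
      moreover have "w i \<in> (if i \<in> F then cball 0 D else {0})" for i
        using nw[of i] D l(1) by (cases "i = l") (simp_all add: w_def)
      ultimately show ?thesis unfolding Q_def by blast
    qed
    ultimately have lt: "(\<Sum>i\<in>F. u i \<bullet> \<Phi> (\<rho>, w) i) < (\<Sum>i\<in>F. u i \<bullet> \<tau> i)" by (intro u) auto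
    have ui: "u i = (v i, f i)" for i by (simp add: v_def f_def)
    have s1: "(\<Sum>i\<in>F. v i \<bullet> (\<Sum>j\<in>F. \<rho> (i, j) *\<^sub>R b j)) = (\<Sum>i\<in>F. n i * (v i \<bullet> b (J i)))"
    proof (intro sum.cong refl)
      fix i assume i: "i \<in> F"
      have "(\<Sum>j\<in>F. \<rho> (i, j) *\<^sub>R b j) = (\<Sum>j\<in>F. if j = J i then n i *\<^sub>R b (J i) else 0)"
        using i by (intro sum.cong) (auto simp: \<rho>_def)
      also have "\<dots> = n i *\<^sub>R b (J i)" using F(1) J(1) by simp
      finally show "v i \<bullet> (\<Sum>j\<in>F. \<rho> (i, j) *\<^sub>R b j) = n i * (v i \<bullet> b (J i))" by simp
    qed
    have s2: "(\<Sum>i\<in>F. v i \<bullet> w i) = D * norm (v l)"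
    proof -
      have "(\<Sum>i\<in>F. v i \<bullet> w i) = (\<Sum>i\<in>F. if i = l then D * norm (v l) else 0)"
      proof (intro sum.cong refl)
        have "v l \<bullet> sgn (v l) = norm (v l)"
          by (cases "v l = 0") (simp_all add: sgn_div_norm dot_square_norm power2_eq_square)
        then show "v i \<bullet> w i = (if i = l then D * norm (v l) else 0)" for i
          by (simp add: w_def)
      qed
      then show ?thesis using F(1) l(1) by simp
    qed
    have s3: "(\<Sum>i\<in>F. f i * (\<Sum>k\<in>F. \<rho> (k, i))) = (\<Sum>i\<in>F. n i * f (J i))"
    proof -
      have "(\<Sum>i\<in>F. f i * (\<Sum>k\<in>F. \<rho> (k, i))) = (\<Sum>k\<in>F. \<Sum>i\<in>F. f i * \<rho> (k, i))"
        unfolding sum_distrib_left by (rule sum.swap)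
      also have "\<dots> = (\<Sum>k\<in>F. \<Sum>i\<in>F. if i = J k then n k * f (J k) else 0)"
        by (intro sum.cong) (auto simp: \<rho>_def)
      finally show ?thesis using F(1) J(1) by simp
    qed
    have "(\<Sum>i\<in>F. u i \<bullet> \<Phi> (\<rho>, w) i) = (\<Sum>i\<in>F. n i * c i) + D * norm (v l)"
      using s1 s2 s3
      by (simp add: ui \<Phi>_def inner_add_right sum.distrib c_def algebra_simps)
    moreover have "(\<Sum>i\<in>F. u i \<bullet> \<tau> i) = (\<Sum>i\<in>F. v i \<bullet> m i) + (\<Sum>j\<in>F. f j * q j)"
      by (simp add: ui \<tau>_def sum.distrib)
    moreover have "(\<Sum>i\<in>F. v i \<bullet> m i) + (\<Sum>j\<in>F. f j * q j) \<le> (\<Sum>i\<in>F. n i * c i) + D * norm (v l)"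
      by (intro dual l(2)) (auto simp: c_def intro: J(2))
    ultimately show False using lt by simp
  qed
  then obtain \<rho> w where rw: "\<rho> \<in> P" "w \<in> Q" "\<And>i. i \<in> F \<Longrightarrow> \<Phi> (\<rho>, w) i = \<tau> i" by auto
  show thesis
  proof (rule that[of "\<lambda>i j. \<rho> (i, j)"])
    show "0 \<le> \<rho> (i, j)" if "i \<in> F" "j \<in> F" for i j
    proof -
      have "\<rho> (i, j) \<in> (if fst (i, j) \<in> F \<and> snd (i, j) \<in> F then {0..n (fst (i, j))} else {0})"
        using rw(1) unfolding P_def by blast
      then show ?thesis using that by simp
    qed
    show "(\<Sum>j\<in>F. \<rho> (i, j)) = n i" if "i \<in> F" for i using rw(1) that by (auto simp: P_def)
    show "(\<Sum>i\<in>F. \<rho> (i, j)) = q j" if "j \<in> F" for j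
      using rw(3)[OF that] by (simp add: \<Phi>_def \<tau>_def)
    have "m i - (\<Sum>j\<in>F. \<rho> (i, j) *\<^sub>R b j) = w i" if "i \<in> F" for i
      using rw(3)[OF that] by (simp add: \<Phi>_def \<tau>_def algebra_simps)
    then have "(\<Sum>i\<in>F. norm (m i - (\<Sum>j\<in>F. \<rho> (i, j) *\<^sub>R b j))) = (\<Sum>i\<in>F. norm (w i))" by simp
    also have "\<dots> \<le> D" using rw(2) by (simp add: Q_def)
    finally show "(\<Sum>i\<in>F. norm (m i - (\<Sum>j\<in>F. \<rho> (i, j) *\<^sub>R b j))) \<le> D" .
  qed
qed

section \<open>Kernels with a density\<close>

lemma weak_cost_distr_le:
  fixes \<mu> :: "'a::euclidean_space measure"
  assumes s: "sets \<mu> = sets borel" and T[measurable]: "T \<in> borel_measurable borel"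
  shows "weak_cost p (distr \<mu> borel T) \<mu> \<le> (\<integral>\<^sup>+x. ennreal (norm (x - T x) powr p) \<partial>\<mu>)"
proof -
  have [measurable_cong]: "sets \<mu> = sets borel" by fact
  let ?\<gamma> = "distr \<mu> (borel \<Otimes>\<^sub>M borel) (\<lambda>x. (x, T x))" and ?\<kappa> = "\<lambda>x. return borel (T x)"
  have "?\<kappa> \<in> borel \<rightarrow>\<^sub>M prob_algebra borel" by measurable
  moreover have "emeasure ?\<gamma> A = (\<integral>\<^sup>+x. (\<integral>\<^sup>+y. indicator A (x, y) \<partial>?\<kappa> x) \<partial>\<mu>)"
    if [measurable]: "A \<in> sets (borel \<Otimes>\<^sub>M borel)" for A
  proof -
    have "emeasure ?\<gamma> A = (\<integral>\<^sup>+z. indicator A z \<partial>?\<gamma>)" by simp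
    also have "\<dots> = (\<integral>\<^sup>+x. indicator A (x, T x) \<partial>\<mu>)" by (rule nn_integral_distr) auto
    also have "\<dots> = (\<integral>\<^sup>+x. (\<integral>\<^sup>+y. indicator A (x, y) \<partial>?\<kappa> x) \<partial>\<mu>)"
      by (intro nn_integral_cong, subst nn_integral_return) auto
    finally show ?thesis .
  qed
  ultimately have "disintegrates ?\<gamma> \<mu> ?\<kappa>" by (simp add: disintegrates_def)
  then have "(?\<gamma>, ?\<kappa>) \<in> {(\<gamma>, \<kappa>). \<gamma> \<in> couplings \<mu> (distr \<mu> borel T) \<and> disintegrates \<gamma> \<mu> \<kappa>}"
    using graph_coupling[OF s T] by simp
  from INF_lower[OF this, of "\<lambda>(\<gamma>, \<kappa>). \<integral>\<^sup>+x. ennreal (norm (x - (\<integral>y. y \<partial>\<kappa> x)) powr p) \<partial>\<mu>"]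
  show ?thesis unfolding weak_cost_def by (simp add: integral_return)
qed

text \<open>
  A function with unit integrals in both variables is the density of a coupling with respect to the
  product of its marginals, and the disintegration of this coupling is explicit.
\<close>

lemma density_kernel:
  fixes \<nu> \<mu> :: "'a::euclidean_space measure" and h :: "'a \<Rightarrow> 'a \<Rightarrow> real"
  assumes \<nu>: "prob_space \<nu>" "sets \<nu> = sets borel" and \<mu>: "prob_space \<mu>" "sets \<mu> = sets borel"
    and h: "(\<lambda>(z, y). h z y) \<in> borel_measurable (borel \<Otimes>\<^sub>M borel)"
    and row: "\<And>z. (\<integral>\<^sup>+y. ennreal (h z y) \<partial>\<mu>) = 1"
    and col: "AE y in \<mu>. (\<integral>\<^sup>+z. ennreal (h z y) \<partial>\<nu>) = 1"
  defines "\<gamma> \<equiv> density (\<nu> \<Otimes>\<^sub>M \<mu>) (\<lambda>(z, y). ennreal (h z y))"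
  shows "\<gamma> \<in> couplings \<nu> \<mu>" "disintegrates \<gamma> \<nu> (\<lambda>z. density \<mu> (\<lambda>y. ennreal (h z y)))"
proof -
  interpret N: prob_space \<nu> by fact
  interpret M: prob_space \<mu> by fact
  interpret P: pair_sigma_finite \<nu> \<mu> ..
  have [measurable_cong]: "sets \<nu> = sets borel" "sets \<mu> = sets borel" by fact+
  have sp: "space \<nu> = UNIV" "space \<mu> = UNIV"
    using sets_eq_imp_space_eq[OF \<nu>(2)] sets_eq_imp_space_eq[OF \<mu>(2)] by auto
  have hp[measurable]: "(\<lambda>x. h (fst x) (snd x)) \<in> borel_measurable (borel \<Otimes>\<^sub>M borel)"
    using h by (simp add: case_prod_beta')
  have hz[measurable]: "h z \<in> borel_measurable borel" for z
    using measurable_compose[OF _ hp, of "\<lambda>y. (z, y)"] by simp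
  have hy[measurable]: "(\<lambda>z. h z y) \<in> borel_measurable borel" for y
    using measurable_compose[OF _ hp, of "\<lambda>z. (z, y)"] by simp
  have em: "emeasure \<gamma> A = (\<integral>\<^sup>+z. \<integral>\<^sup>+y. ennreal (h z y) * indicator A (z, y) \<partial>\<mu> \<partial>\<nu>)"
    and em': "emeasure \<gamma> A = (\<integral>\<^sup>+y. \<integral>\<^sup>+z. ennreal (h z y) * indicator A (z, y) \<partial>\<nu> \<partial>\<mu>)"
    if A[measurable]: "A \<in> sets (borel \<Otimes>\<^sub>M borel)" for A
  proof -
    have "emeasure \<gamma> A = (\<integral>\<^sup>+x. ennreal (h (fst x) (snd x)) * indicator A x \<partial>(\<nu> \<Otimes>\<^sub>M \<mu>))"
      unfolding \<gamma>_def by (subst emeasure_density) (auto simp: case_prod_beta')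
    moreover have "(\<lambda>x. ennreal (h (fst x) (snd x)) * indicator A x) \<in> borel_measurable (\<nu> \<Otimes>\<^sub>M \<mu>)"
      by measurable
    note M.nn_integral_fst[OF this] P.nn_integral_snd[OF this]
    ultimately show "emeasure \<gamma> A = (\<integral>\<^sup>+z. \<integral>\<^sup>+y. ennreal (h z y) * indicator A (z, y) \<partial>\<mu> \<partial>\<nu>)"
        "emeasure \<gamma> A = (\<integral>\<^sup>+y. \<integral>\<^sup>+z. ennreal (h z y) * indicator A (z, y) \<partial>\<nu> \<partial>\<mu>)"
      by simp_all
  qed
  have sg: "sets \<gamma> = sets (borel \<Otimes>\<^sub>M borel)" unfolding \<gamma>_def by simp (intro sets_pair_measure_cong \<nu> \<mu>)
  note [measurable_cong] = sg
  have spg: "space \<gamma> = UNIV" using sets_eq_imp_space_eq[OF sg] by (simp add: space_pair_measure)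
  have "distr \<gamma> borel fst = \<nu>"
  proof (rule measure_eqI)
    fix B assume "B \<in> sets (distr \<gamma> borel fst)"
    then have [measurable]: "B \<in> sets borel" by simp
    have "emeasure (distr \<gamma> borel fst) B = emeasure \<gamma> (fst -` B)"
      by (subst emeasure_distr) (auto simp: spg)
    also have "fst -` B = B \<times> (UNIV :: 'a set)" by auto
    also have "emeasure \<gamma> \<dots> = (\<integral>\<^sup>+z. \<integral>\<^sup>+y. ennreal (h z y) * indicator (B \<times> UNIV) (z, y) \<partial>\<mu> \<partial>\<nu>)"
      by (rule em) simp
    also have "\<dots> = (\<integral>\<^sup>+z. indicator B z \<partial>\<nu>)"
    proof (rule nn_integral_cong)
      fix z
      have "(\<integral>\<^sup>+y. ennreal (h z y) * indicator (B \<times> UNIV) (z, y) \<partial>\<mu>) = (\<integral>\<^sup>+y. ennreal (h z y) * indicator B z \<partial>\<mu>)"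
        by (simp add: indicator_times)
      also have "\<dots> = indicator B z" by (subst nn_integral_multc) (simp_all add: row)
      finally show "(\<integral>\<^sup>+y. ennreal (h z y) * indicator (B \<times> UNIV) (z, y) \<partial>\<mu>) = indicator B z" .
    qed
    also have "\<dots> = emeasure \<nu> B" by simp
    finally show "emeasure (distr \<gamma> borel fst) B = emeasure \<nu> B" .
  qed (simp add: \<nu>)
  moreover have "distr \<gamma> borel snd = \<mu>"
  proof (rule measure_eqI)
    fix B assume "B \<in> sets (distr \<gamma> borel snd)"
    then have [measurable]: "B \<in> sets borel" by simp
    have "emeasure (distr \<gamma> borel snd) B = emeasure \<gamma> (snd -` B)"
      by (subst emeasure_distr) (auto simp: spg)
    also have "snd -` B = (UNIV :: 'a set) \<times> B" by auto
    also have "emeasure \<gamma> \<dots> = (\<integral>\<^sup>+y. \<integral>\<^sup>+z. ennreal (h z y) * indicator (UNIV \<times> B) (z, y) \<partial>\<nu> \<partial>\<mu>)"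
      by (rule em') simp
    also have "\<dots> = (\<integral>\<^sup>+y. indicator B y \<partial>\<mu>)"
    proof (rule nn_integral_cong_AE)
      show "AE y in \<mu>. (\<integral>\<^sup>+z. ennreal (h z y) * indicator (UNIV \<times> B) (z, y) \<partial>\<nu>) = indicator B y"
        using col
      proof eventually_elim
        case (elim y)
        have "(\<integral>\<^sup>+z. ennreal (h z y) * indicator (UNIV \<times> B) (z, y) \<partial>\<nu>) = (\<integral>\<^sup>+z. ennreal (h z y) * indicator B y \<partial>\<nu>)"
          by (simp add: indicator_times)
        also have "\<dots> = indicator B y" by (subst nn_integral_multc) (simp_all add: elim)
        finally show ?case .
      qed
    qed
    also have "\<dots> = emeasure \<mu> B" by simp
    finally show "emeasure (distr \<gamma> borel snd) B = emeasure \<mu> B" .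
  qed (simp add: \<mu>)
  ultimately show "\<gamma> \<in> couplings \<nu> \<mu>" using sg by (simp add: couplings_def)
  have pk: "prob_space (density \<mu> (\<lambda>y. ennreal (h z y)))" for z
    by (intro prob_spaceI) (simp add: emeasure_density row cong: nn_integral_cong)
  have "(\<lambda>z. density \<mu> (\<lambda>y. ennreal (h z y))) \<in> borel \<rightarrow>\<^sub>M prob_algebra borel"
  proof (intro measurable_prob_algebraI measurable_subprob_algebra pk)
    show "subprob_space (density \<mu> (\<lambda>y. ennreal (h z y)))" for z
      using pk by (rule prob_space_imp_subprob_space)
    show "(\<lambda>z. emeasure (density \<mu> (\<lambda>y. ennreal (h z y))) A) \<in> borel_measurable borel"
      if [measurable]: "A \<in> sets borel" for A
    proof -
      have "(\<lambda>z. \<integral>\<^sup>+y. ennreal (h z y) * indicator A y \<partial>\<mu>) \<in> borel_measurable borel"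
        by measurable
      moreover have "emeasure (density \<mu> (\<lambda>y. ennreal (h z y))) A = (\<integral>\<^sup>+y. ennreal (h z y) * indicator A y \<partial>\<mu>)" for z
        by (rule emeasure_density) auto
      ultimately show ?thesis by simp
    qed
  qed (simp add: \<mu>)
  moreover have "emeasure \<gamma> A = (\<integral>\<^sup>+z. (\<integral>\<^sup>+y. indicator A (z, y) \<partial>density \<mu> (\<lambda>y. ennreal (h z y))) \<partial>\<nu>)"
    if [measurable]: "A \<in> sets (borel \<Otimes>\<^sub>M borel)" for A
    unfolding em[OF that] by (intro nn_integral_cong, subst nn_integral_density) auto
  ultimately show "disintegrates \<gamma> \<nu> (\<lambda>z. density \<mu> (\<lambda>y. ennreal (h z y)))"
    by (simp add: disintegrates_def)
qed

lemma weak_cost_density_kernel_le: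
  fixes \<nu> \<mu> :: "'a::euclidean_space measure" and h :: "'a \<Rightarrow> 'a \<Rightarrow> real"
  assumes "prob_space \<nu>" "sets \<nu> = sets borel" "prob_space \<mu>" "sets \<mu> = sets borel"
    and h: "(\<lambda>(z, y). h z y) \<in> borel_measurable (borel \<Otimes>\<^sub>M borel)" "\<And>z y. 0 \<le> h z y"
    and "\<And>z. (\<integral>\<^sup>+y. ennreal (h z y) \<partial>\<mu>) = 1"
    and "AE y in \<mu>. (\<integral>\<^sup>+z. ennreal (h z y) \<partial>\<nu>) = 1"
  shows "weak_cost p \<mu> \<nu> \<le> (\<integral>\<^sup>+z. ennreal (norm (z - (\<integral>y. h z y *\<^sub>R y \<partial>\<mu>)) powr p) \<partial>\<nu>)"
proof -
  let ?\<gamma> = "density (\<nu> \<Otimes>\<^sub>M \<mu>) (\<lambda>(z, y). ennreal (h z y))"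
  let ?\<kappa> = "\<lambda>z. density \<mu> (\<lambda>y. ennreal (h z y))"
  have [measurable_cong]: "sets \<mu> = sets borel" by fact
  have hz: "h z \<in> borel_measurable \<mu>" for z
    using measurable_compose[OF _ h(1), of "\<lambda>y. (z, y)"] by simp
  have "(?\<gamma>, ?\<kappa>) \<in> {(\<gamma>, \<kappa>). \<gamma> \<in> couplings \<nu> \<mu> \<and> disintegrates \<gamma> \<nu> \<kappa>}"
    using density_kernel[OF assms(1-5,7,8)] by simp
  from INF_lower[OF this, of "\<lambda>(\<gamma>, \<kappa>). \<integral>\<^sup>+x. ennreal (norm (x - (\<integral>y. y \<partial>\<kappa> x)) powr p) \<partial>\<nu>"]
  have "weak_cost p \<mu> \<nu> \<le> (\<integral>\<^sup>+z. ennreal (norm (z - (\<integral>y. y \<partial>?\<kappa> z)) powr p) \<partial>\<nu>)"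
    unfolding weak_cost_def by simp
  moreover have "(\<integral>y. y \<partial>?\<kappa> z) = (\<integral>y. h z y *\<^sub>R y \<partial>\<mu>)" for z
    by (rule integral_density) (use hz h(2) in auto)
  ultimately show ?thesis by simp
qed

section \<open>Approximate martingale plans\<close>

lemma finite_valued_rounding:
  fixes \<Omega> :: "'a::euclidean_space set"
  assumes "compact \<Omega>" "0 < \<delta>"
  obtains r :: "'a \<Rightarrow> 'a" and F where "finite F" "range r \<subseteq> F"
    "r \<in> borel \<rightarrow>\<^sub>M count_space UNIV" "\<And>y. y \<in> \<Omega> \<Longrightarrow> norm (y - r y) \<le> \<delta>"
proof -
  obtain K where K: "finite K" "\<Omega> \<subseteq> (\<Union>x\<in>K. ball x \<delta>)"
    using assms unfolding compact_eq_totally_bounded by blast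
  have "\<exists>r::'a \<Rightarrow> 'a. range r \<subseteq> insert 0 K \<and> r \<in> borel \<rightarrow>\<^sub>M count_space UNIV \<and>
      (\<forall>y\<in>(\<Union>x\<in>K. ball x \<delta>). norm (y - r y) \<le> \<delta>)"
    using K(1)
  proof induction
    case empty
    show ?case by (rule exI[of _ "\<lambda>_. 0"]) auto
  next
    case (insert a K)
    then obtain r :: "'a \<Rightarrow> 'a" where r: "range r \<subseteq> insert 0 K" "r \<in> borel \<rightarrow>\<^sub>M count_space UNIV"
      "\<And>y. y \<in> (\<Union>x\<in>K. ball x \<delta>) \<Longrightarrow> norm (y - r y) \<le> \<delta>" by blast
    let ?r = "\<lambda>y. if y \<in> ball a \<delta> then a else r y"
    note [measurable] = r(2)
    have [measurable]: "ball a \<delta> \<in> sets borel" by simp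
    have "range ?r \<subseteq> insert 0 (insert a K)" using r(1) by auto
    moreover have "?r \<in> borel \<rightarrow>\<^sub>M count_space UNIV" by measurable
    moreover have "norm (y - ?r y) \<le> \<delta>" if "y \<in> (\<Union>x\<in>insert a K. ball x \<delta>)" for y
      using that r(3)[of y] by (auto simp: dist_norm norm_minus_commute)
    ultimately show ?case by blast
  qed
  then show thesis using that K by (meson finite.insertI subsetD)
qed

lemma integral_finite_valued:
  fixes f :: "'i \<Rightarrow> 'b::{banach, second_countable_topology}"
  assumes "finite_measure M" "finite F" "c \<in> M \<rightarrow>\<^sub>M count_space UNIV" "range c \<subseteq> F"
  shows "(\<integral>x. f (c x) \<partial>M) = (\<Sum>j\<in>F. measure M {x \<in> space M. c x = j} *\<^sub>R f j)"
    and "integrable M (\<lambda>x. f (c x))"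
proof -
  interpret finite_measure M by fact
  note [measurable] = assms(3)
  have "f (c x) = (\<Sum>j\<in>F. indicator {x \<in> space M. c x = j} x *\<^sub>R f j)" if "x \<in> space M" for x
  proof -
    have "(\<Sum>j\<in>F. indicator {x \<in> space M. c x = j} x *\<^sub>R f j) = (\<Sum>j\<in>F. if c x = j then f j else 0)"
      using that by (intro sum.cong) auto
    also have "\<dots> = f (c x)" using assms(2,4) by auto
    finally show ?thesis ..
  qed
  note eq = this
  have i: "integrable M (\<lambda>x. indicator {x \<in> space M. c x = j} x *\<^sub>R f j)" for j
    by (intro integrable_scaleR_left integrable_indicator_finite_measure[OF assms(1)]) measurable
  show "integrable M (\<lambda>x. f (c x))"
    by (subst Bochner_Integration.integrable_cong[OF refl eq]) (auto intro: i)
  have "(\<integral>x. f (c x) \<partial>M) = (\<integral>x. (\<Sum>j\<in>F. indicator {x \<in> space M. c x = j} x *\<^sub>R f j) \<partial>M)"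
    by (intro Bochner_Integration.integral_cong eq refl)
  also have "\<dots> = (\<Sum>j\<in>F. \<integral>x. indicator {x \<in> space M. c x = j} x *\<^sub>R f j \<partial>M)"
    by (rule Bochner_Integration.integral_sum) (rule i)
  also have "\<dots> = (\<Sum>j\<in>F. measure M {x \<in> space M. c x = j} *\<^sub>R f j)"
  proof (intro sum.cong refl)
    fix j
    have m: "{x \<in> space M. c x = j} \<in> sets M" by measurable
    have "(\<integral>x. indicator {x \<in> space M. c x = j} x *\<^sub>R f j \<partial>M)
        = (\<integral>x. indicator {x \<in> space M. c x = j} x \<partial>M) *\<^sub>R f j"
      by (intro integral_scaleR_left integrable_indicator_finite_measure[OF assms(1) m])
    then show "(\<integral>x. indicator {x \<in> space M. c x = j} x *\<^sub>R f j \<partial>M)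
        = measure M {x \<in> space M. c x = j} *\<^sub>R f j"
      using m by (simp add: Int_absorb2 sets.sets_into_space)
  qed
  finally show "(\<integral>x. f (c x) \<partial>M) = (\<Sum>j\<in>F. measure M {x \<in> space M. c x = j} *\<^sub>R f j)" .
qed

text \<open>
  Cells without mass are almost surely avoided, which justifies the divisions by the mass of a cell.
\<close>

lemma AE_finite_valued_nonnull:
  assumes "finite_measure M" "finite F" "c \<in> M \<rightarrow>\<^sub>M count_space UNIV" "range c \<subseteq> F"
  shows "AE x in M. measure M {x' \<in> space M. c x' = c x} \<noteq> 0"
proof -
  interpret finite_measure M by fact
  note [measurable] = assms(3)
  have "AE x in M. measure M {x' \<in> space M. c x' = j} = 0 \<longrightarrow> c x \<noteq> j" for j
  proof (cases "measure M {x' \<in> space M. c x' = j} = 0")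
    case True
    then have "emeasure M {x' \<in> space M. c x' = j} = 0" by (simp add: emeasure_eq_measure)
    then show ?thesis by (intro AE_I[of _ _ "{x' \<in> space M. c x' = j}"]) auto
  qed simp
  then have "AE x in M. \<forall>j\<in>F. measure M {x' \<in> space M. c x' = j} = 0 \<longrightarrow> c x \<noteq> j"
    using assms(2) by (simp add: AE_finite_all)
  then show ?thesis
    by eventually_elim (use assms(4) in auto)
qed

lemma convex_on_Max_affine:
  fixes v :: "'i \<Rightarrow> 'a::euclidean_space"
  assumes "finite F" "F \<noteq> {}"
  shows "convex_on UNIV (\<lambda>y. Max ((\<lambda>i. v i \<bullet> y - c i) ` F))"
proof (rule convex_onI)
  fix u :: real and x y :: 'a assume u: "0 < u" "u < 1"
  let ?m = "\<lambda>y. Max ((\<lambda>i. v i \<bullet> y - c i) ` F)"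
  have le: "v i \<bullet> z - c i \<le> ?m z" if "i \<in> F" for i z using assms that by (intro Max_ge) auto
  have "v i \<bullet> ((1 - u) *\<^sub>R x + u *\<^sub>R y) - c i \<le> (1 - u) * ?m x + u * ?m y" if "i \<in> F" for i
  proof -
    have "v i \<bullet> ((1 - u) *\<^sub>R x + u *\<^sub>R y) - c i = (1 - u) * (v i \<bullet> x - c i) + u * (v i \<bullet> y - c i)"
      by (simp add: algebra_simps)
    also have "\<dots> \<le> (1 - u) * ?m x + u * ?m y"
      using u le[OF that] by (intro add_mono mult_left_mono) auto
    finally show ?thesis .
  qed
  then show "?m ((1 - u) *\<^sub>R x + u *\<^sub>R y) \<le> (1 - u) * ?m x + u * ?m y"
    using assms by (subst Max_le_iff) auto
qed simp

text \<open>
  An approximate form of Strassen's theorem. The rows are the cells of the labelling \<open>c\<close>, with moments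
  \<open>\<integral>\<^bsub>c=i\<^esub> S dM\<close>; the columns are the cells of the rounding \<open>r\<close> on the side of \<open>\<mu>\<close>. A violation of the dual
  condition would contradict the convex order for \<open>\<phi>(y) = max\<^sub>i (v\<^sub>i \<bullet> y - k\<^sub>i)\<close>, which is Lipschitz
  with the constant \<open>L\<close> of the dual problem; rounding points of \<open>\<Omega>\<close> therefore costs at most \<open>L \<delta>\<close>.
\<close>

lemma approximate_martingale_plan:
  fixes \<mu> :: "'a::euclidean_space measure" and S :: "'b \<Rightarrow> 'a" and c :: "'b \<Rightarrow> 'a"
  assumes \<Omega>: "compact \<Omega>" and M: "prob_space M"
    and S: "S \<in> borel_measurable M" "AE x in M. S x \<in> \<Omega>"
    and cx: "distr M borel S \<le>\<^sub>c\<^sub>x \<mu>" and \<mu>: "\<mu> \<in> prob_on \<Omega>"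
    and F: "finite F" "F \<noteq> {}"
    and r: "r \<in> borel \<rightarrow>\<^sub>M count_space UNIV" "range r \<subseteq> F" "\<And>y. y \<in> \<Omega> \<Longrightarrow> norm (y - r y) \<le> \<delta>"
    and c: "c \<in> M \<rightarrow>\<^sub>M count_space UNIV" "range c \<subseteq> F" and \<delta>: "0 \<le> \<delta>"
  obtains \<rho> where "\<And>i j. i \<in> F \<Longrightarrow> j \<in> F \<Longrightarrow> 0 \<le> \<rho> i j"
    "\<And>i. i \<in> F \<Longrightarrow> (\<Sum>j\<in>F. \<rho> i j) = measure M {x \<in> space M. c x = i}"
    "\<And>j. j \<in> F \<Longrightarrow> (\<Sum>i\<in>F. \<rho> i j) = measure \<mu> {y. r y = j}"
    "(\<Sum>i\<in>F. norm ((\<integral>x. indicator {x \<in> space M. c x = i} x *\<^sub>R S x \<partial>M) - (\<Sum>j\<in>F. \<rho> i j *\<^sub>R j))) \<le> \<delta>"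
proof -
  interpret M: prob_space M by fact
  note m = prob_onD[OF \<mu>]
  interpret N: prob_space \<mu> by (rule m)
  have \<Omega>b[measurable]: "\<Omega> \<in> sets borel" using \<Omega>(1) by (simp add: borel_compact)
  have [measurable_cong]: "sets \<mu> = sets borel" by (rule m)
  note [measurable] = S(1) r(1) c(1)
  have iS: "integrable M S" by (intro integrable_AE_compact[OF M.finite_measure_axioms S \<Omega>])
  define A where "A i = {x \<in> space M. c x = i}" for i
  have A[measurable]: "A i \<in> sets M" for i unfolding A_def by measurable
  note ind = integrable_indicator_finite_measure[OF M.finite_measure_axioms A]
  have iAS: "integrable M (\<lambda>x. indicator (A i) x *\<^sub>R S x)" for i
    using A iS by (rule integrable_mult_indicator)
  show thesis
  proof (rule transport_plan_duality[OF F, of "\<lambda>i. measure M (A i)" \<delta> "\<lambda>j. j"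
        "\<lambda>i. \<integral>x. indicator (A i) x *\<^sub>R S x \<partial>M" "\<lambda>j. measure \<mu> {y. r y = j}"])
    fix v :: "'a \<Rightarrow> 'a" and f k :: "'a \<Rightarrow> real" and L :: real
    assume L: "\<And>i. i \<in> F \<Longrightarrow> norm (v i) \<le> L"
      and k: "\<And>i j. i \<in> F \<Longrightarrow> j \<in> F \<Longrightarrow> v i \<bullet> j + f j \<le> k i"
    define \<phi> where "\<phi> y = Max ((\<lambda>i. v i \<bullet> y - k i) ` F)" for y
    have cv: "convex_on UNIV \<phi>" unfolding \<phi>_def by (rule convex_on_Max_affine[OF F])
    note [measurable] = convex_bounded_on_compact(1)[OF cv \<Omega>]
    obtain B where B: "\<And>y. y \<in> \<Omega> \<Longrightarrow> \<bar>\<phi> y\<bar> \<le> B"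
      using convex_bounded_on_compact(2)[OF cv \<Omega>] by blast
    have ge: "v i \<bullet> y - k i \<le> \<phi> y" if "i \<in> F" for i y
      unfolding \<phi>_def using F that by (intro Max_ge) auto
    have lip: "\<phi> y \<le> - f (r y) + L * \<delta>" if y: "y \<in> \<Omega>" for y
      unfolding \<phi>_def
    proof (subst Max_le_iff, use F in simp, use F in simp, intro ballI, elim imageE)
      fix a i assume a: "a = v i \<bullet> y - k i" "i \<in> F"
      have "v i \<bullet> (y - r y) \<le> norm (v i) * norm (y - r y)" by (rule norm_cauchy_schwarz)
      also have "\<dots> \<le> L * \<delta>"
        using L[OF a(2)] r(3)[OF y] by (intro mult_mono) (auto intro: order_trans[OF norm_ge_zero])
      finally have "v i \<bullet> (y - r y) \<le> L * \<delta>" .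
      moreover have "v i \<bullet> r y + f (r y) \<le> k i" using k[OF a(2)] r(2) by blast
      ultimately show "a \<le> - f (r y) + L * \<delta>" unfolding a by (simp add: inner_diff_right)
    qed
    have "(\<Sum>i\<in>F. v i \<bullet> (\<integral>x. indicator (A i) x *\<^sub>R S x \<partial>M)) - (\<Sum>i\<in>F. measure M (A i) * k i)
        = (\<Sum>i\<in>F. \<integral>x. v i \<bullet> (indicator (A i) x *\<^sub>R S x) - indicator (A i) x * k i \<partial>M)"
      unfolding sum_subtractf[symmetric]
    proof (intro sum.cong refl)
      fix i
      have "(\<integral>x. v i \<bullet> (indicator (A i) x *\<^sub>R S x) - indicator (A i) x * k i \<partial>M)
          = (\<integral>x. v i \<bullet> (indicator (A i) x *\<^sub>R S x) \<partial>M) - (\<integral>x. indicator (A i) x * k i \<partial>M)"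
        by (intro Bochner_Integration.integral_diff integrable_inner_right integrable_mult_left iAS ind)
      also have "(\<integral>x. v i \<bullet> (indicator (A i) x *\<^sub>R S x) \<partial>M) = v i \<bullet> (\<integral>x. indicator (A i) x *\<^sub>R S x \<partial>M)"
        by (intro integral_inner_right iAS)
      also have "(\<integral>x. indicator (A i) x * k i \<partial>M) = measure M (A i) * k i" by simp
      finally show "v i \<bullet> (\<integral>x. indicator (A i) x *\<^sub>R S x \<partial>M) - measure M (A i) * k i
          = (\<integral>x. v i \<bullet> (indicator (A i) x *\<^sub>R S x) - indicator (A i) x * k i \<partial>M)" ..
    qed
    also have "\<dots> = (\<integral>x. (\<Sum>i\<in>F. v i \<bullet> (indicator (A i) x *\<^sub>R S x) - indicator (A i) x * k i) \<partial>M)"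
      by (intro Bochner_Integration.integral_sum[symmetric] Bochner_Integration.integrable_diff
          integrable_inner_right integrable_mult_left iAS ind)
    also have "\<dots> \<le> (\<integral>x. \<phi> (S x) \<partial>M)"
    proof (rule integral_mono_AE)
      show "integrable M (\<lambda>x. \<Sum>i\<in>F. v i \<bullet> (indicator (A i) x *\<^sub>R S x) - indicator (A i) x * k i)"
        by (intro Bochner_Integration.integrable_sum Bochner_Integration.integrable_diff
            integrable_inner_right integrable_mult_left iAS ind)
      show "integrable M (\<lambda>x. \<phi> (S x))"
        using S(2) B by (intro M.integrable_const_bound[of _ B]) (auto elim!: eventually_mono)
      show "AE x in M. (\<Sum>i\<in>F. v i \<bullet> (indicator (A i) x *\<^sub>R S x) - indicator (A i) x * k i) \<le> \<phi> (S x)"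
      proof (rule AE_I2)
        fix x assume x: "x \<in> space M"
        have cx: "c x \<in> F" using c(2) by auto
        have "(\<Sum>i\<in>F. v i \<bullet> (indicator (A i) x *\<^sub>R S x) - indicator (A i) x * k i)
            = (\<Sum>i\<in>F. if c x = i then v i \<bullet> S x - k i else 0)"
          using x by (intro sum.cong) (auto simp: A_def)
        also have "\<dots> = v (c x) \<bullet> S x - k (c x)" using F cx by simp
        also have "\<dots> \<le> \<phi> (S x)" by (rule ge[OF cx])
        finally show "(\<Sum>i\<in>F. v i \<bullet> (indicator (A i) x *\<^sub>R S x) - indicator (A i) x * k i) \<le> \<phi> (S x)" .
      qed
    qed
    also have "\<dots> = (\<integral>y. \<phi> y \<partial>distr M borel S)" by (rule integral_distr[symmetric]) auto
    also have "\<dots> \<le> (\<integral>y. \<phi> y \<partial>\<mu>)" using cx cv unfolding convex_order_def by blast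
    also have "\<dots> \<le> (\<integral>y. - f (r y) + L * \<delta> \<partial>\<mu>)"
    proof (rule integral_mono_AE)
      show "integrable \<mu> \<phi>"
        using m(4)[OF \<Omega>b] B by (intro N.integrable_const_bound[of _ B]) (auto elim!: eventually_mono)
      show "integrable \<mu> (\<lambda>y. - f (r y) + L * \<delta>)"
        using integral_finite_valued(2)[OF N.finite_measure_axioms F(1) _ r(2), of f] by simp
      show "AE y in \<mu>. \<phi> y \<le> - f (r y) + L * \<delta>"
        using m(4)[OF \<Omega>b] lip by (auto elim!: eventually_mono)
    qed
    also have "\<dots> = - (\<Sum>j\<in>F. f j * measure \<mu> {y. r y = j}) + L * \<delta>"
      using integral_finite_valued[OF N.finite_measure_axioms F(1) _ r(2), of f]
      by (simp add: N.prob_space[unfolded m(3)] m(3) mult.commute)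
    finally show "(\<Sum>i\<in>F. v i \<bullet> (\<integral>x. indicator (A i) x *\<^sub>R S x \<partial>M)) + (\<Sum>j\<in>F. f j * measure \<mu> {y. r y = j})
        \<le> (\<Sum>i\<in>F. measure M (A i) * k i) + \<delta> * L"
      by (simp add: mult.commute)
  next
    fix \<rho> :: "'a \<Rightarrow> 'a \<Rightarrow> real"
    assume "\<And>i j. i \<in> F \<Longrightarrow> j \<in> F \<Longrightarrow> 0 \<le> \<rho> i j" "\<And>i. i \<in> F \<Longrightarrow> (\<Sum>j\<in>F. \<rho> i j) = measure M (A i)"
      "\<And>j. j \<in> F \<Longrightarrow> (\<Sum>i\<in>F. \<rho> i j) = measure \<mu> {y. r y = j}"
      "(\<Sum>i\<in>F. norm ((\<integral>x. indicator (A i) x *\<^sub>R S x \<partial>M) - (\<Sum>j\<in>F. \<rho> i j *\<^sub>R j))) \<le> \<delta>"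
    then show thesis unfolding A_def by (rule that)
  qed (use \<delta> in auto)
qed

section \<open>The upper bound: the weak cost of a transport followed by a dilation\<close>

lemma norm_triangle_sub_via: "norm (x - y) \<le> norm (x - z) + norm (z - y)" for x y z :: "'a::real_normed_vector"
  using norm_triangle_ineq[of "x - z" "z - y"] by simp

text \<open>
  The plan \<open>\<rho>\<close> between cells of \<open>T\<close> and cells of \<open>\<mu>\<close> becomes a kernel by conditioning \<open>\<mu>\<close> on cells. On
  a cell \<open>i\<close> of \<open>T\<close> its barycenter is close to the mean of \<open>S\<close> over the cell, so its distance from
  \<open>T x\<close> is at most the cell mean of \<open>|T - S|\<close> up to errors. These errors are small only in total, not in
  each cell; this suffices because on bounded sets the \<open>p\<close>-th power depends linearly on them
  (\<open>powr_add_le_linear\<close>).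
\<close>

lemma weak_cost_le_transport_approx:
  fixes M :: "'b measure" and \<mu> :: "'a::euclidean_space measure" and S T :: "'b \<Rightarrow> 'a"
  assumes \<Omega>: "compact \<Omega>" and p: "1 < p" and M: "prob_space M"
    and T: "T \<in> borel_measurable M" "AE x in M. T x \<in> \<Omega>"
    and S: "S \<in> borel_measurable M" "AE x in M. S x \<in> \<Omega>"
    and cx: "distr M borel S \<le>\<^sub>c\<^sub>x \<mu>" and \<mu>: "\<mu> \<in> prob_on \<Omega>"
    and R: "\<And>y. y \<in> \<Omega> \<Longrightarrow> norm y \<le> R" "0 \<le> R" and \<delta>: "0 < \<delta>" "\<delta> \<le> 1"
  defines "K \<equiv> p * (4 * R + 2) powr (p - 1)"
  shows "weak_cost p \<mu> (distr M borel T) \<le> ennreal ((\<integral>x. norm (T x - S x) powr p \<partial>M) + 4 * K * \<delta>)"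
proof -
  interpret M: prob_space M by fact
  note m = prob_onD[OF \<mu>]
  interpret N: prob_space \<mu> by (rule m)
  have \<Omega>b[measurable]: "\<Omega> \<in> sets borel" using \<Omega>(1) by (simp add: borel_compact)
  have [measurable_cong]: "sets \<mu> = sets borel" by (rule m)
  note [measurable] = S(1) T(1)
  have K0: "0 \<le> K" using p by (simp add: K_def)
  obtain r :: "'a \<Rightarrow> 'a" and F where F: "finite F" and r: "range r \<subseteq> F"
    and rm[measurable]: "r \<in> borel \<rightarrow>\<^sub>M count_space UNIV"
    and rd: "\<And>y. y \<in> \<Omega> \<Longrightarrow> norm (y - r y) \<le> \<delta>"
    using finite_valued_rounding[OF \<Omega> \<delta>(1)] by metis
  have Fne: "F \<noteq> {}" using r by auto
  have rF: "r y \<in> F" for y using r by auto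
  have rm\<mu>: "r \<in> \<mu> \<rightarrow>\<^sub>M count_space UNIV" by measurable
  define c where "c x = r (T x)" for x
  have cm[measurable]: "c \<in> M \<rightarrow>\<^sub>M count_space UNIV" unfolding c_def by measurable
  have cF: "range c \<subseteq> F" using rF by (auto simp: c_def)
  define A where "A i = {x \<in> space M. c x = i}" for i
  have A[measurable]: "A i \<in> sets M" for i unfolding A_def by measurable
  define n where "n i = measure M (A i)" for i
  define q where "q j = measure \<mu> {y. r y = j}" for j
  define mS where "mS i = (\<integral>x. indicator (A i) x *\<^sub>R S x \<partial>M)" for i
  obtain \<rho> where \<rho>0: "\<And>i j. i \<in> F \<Longrightarrow> j \<in> F \<Longrightarrow> 0 \<le> \<rho> i j"
    and \<rho>n: "\<And>i. i \<in> F \<Longrightarrow> (\<Sum>j\<in>F. \<rho> i j) = n i" and \<rho>q: "\<And>j. j \<in> F \<Longrightarrow> (\<Sum>i\<in>F. \<rho> i j) = q j"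
    and \<rho>S: "(\<Sum>i\<in>F. norm (mS i - (\<Sum>j\<in>F. \<rho> i j *\<^sub>R j))) \<le> \<delta>"
  proof (rule approximate_martingale_plan[OF \<Omega> M S cx \<mu> F Fne rm r rd cm cF less_imp_le[OF \<delta>(1)],
        folded A_def, folded n_def q_def mS_def])
    fix \<rho> :: "'a \<Rightarrow> 'a \<Rightarrow> real"
    assume "\<And>i j. i \<in> F \<Longrightarrow> j \<in> F \<Longrightarrow> 0 \<le> \<rho> i j" "\<And>i. i \<in> F \<Longrightarrow> (\<Sum>j\<in>F. \<rho> i j) = n i"
      "\<And>j. j \<in> F \<Longrightarrow> (\<Sum>i\<in>F. \<rho> i j) = q j"
      "(\<Sum>i\<in>F. norm (mS i - (\<Sum>j\<in>F. \<rho> i j *\<^sub>R j))) \<le> \<delta>"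
    then show thesis by (rule that)
  qed
  have n0: "0 \<le> n i" for i by (simp add: n_def)
  have q0: "0 \<le> q i" for i by (simp add: q_def)
  have \<rho>q0: "\<rho> i j = 0" if "i \<in> F" "j \<in> F" "q j = 0" for i j
    using \<rho>q[OF that(2)] that F \<rho>0 by (simp add: sum_nonneg_eq_0_iff)
  have \<rho>n0: "\<rho> i j = 0" if "i \<in> F" "j \<in> F" "n i = 0" for i j
    using \<rho>n[OF that(1)] that F \<rho>0 by (simp add: sum_nonneg_eq_0_iff)
  define g where "g i j = \<rho> i j / q j" for i j
  have g0: "0 \<le> g i j" if "i \<in> F" "j \<in> F" for i j using \<rho>0[OF that] q0 by (simp add: g_def)
  have qg: "q j * g i j = \<rho> i j" if "i \<in> F" "j \<in> F" for i j
    using \<rho>q0[OF that] by (simp add: g_def)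
  have int\<mu>: "(\<integral>y. f (r y) \<partial>\<mu>) = (\<Sum>j\<in>F. q j *\<^sub>R f j)" "integrable \<mu> (\<lambda>y. f (r y))"
    for f :: "'a \<Rightarrow> 'c::{banach, second_countable_topology}"
    using integral_finite_valued[OF N.finite_measure_axioms F rm\<mu> r, of f]
    by (simp_all add: m(3) q_def)
  have intM: "(\<integral>x. f (c x) \<partial>M) = (\<Sum>i\<in>F. n i *\<^sub>R f i)" "integrable M (\<lambda>x. f (c x))"
    for f :: "'a \<Rightarrow> 'c::{banach, second_countable_topology}"
    using integral_finite_valued[OF M.finite_measure_axioms F cm cF, of f]
    by (simp_all add: n_def A_def)
  have g_int: "(\<integral>y. g i (r y) \<partial>\<mu>) = n i" if "i \<in> F" for i
    using int\<mu>(1)[of "g i"] qg that \<rho>n by simp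
  have sumq: "(\<Sum>j\<in>F. q j) = 1" using int\<mu>(1)[of "\<lambda>_. 1::real"] N.prob_space by simp
  have sumn: "(\<Sum>j\<in>F. n j) = 1" using intM(1)[of "\<lambda>_. 1::real"] M.prob_space by simp

  \<comment> \<open>\<open>H\<close> is the density of the plan with respect to the product of the marginals. On rows without
    mass any density with integral \<open>1\<close> will do.\<close>
  define H where "H i j = (if n i = 0 then 1 else g i j / n i)" for i j
  have H0: "0 \<le> H i j" if "i \<in> F" "j \<in> F" for i j using g0[OF that] n0 by (simp add: H_def)
  define \<nu> where "\<nu> = distr M borel T"
  have \<nu>: "prob_space \<nu>" "sets \<nu> = sets borel" unfolding \<nu>_def by (auto intro: M.prob_space_distr)
  have \<nu>r: "(\<integral>z. f (r z) \<partial>\<nu>) = (\<Sum>i\<in>F. n i *\<^sub>R f i)" "integrable \<nu> (\<lambda>z. f (r z))"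
    for f :: "'a \<Rightarrow> real"
  proof -
    have [measurable]: "(\<lambda>z. f (r z)) \<in> borel_measurable borel"
      using measurable_compose[OF rm, of f borel] by simp
    show "(\<integral>z. f (r z) \<partial>\<nu>) = (\<Sum>i\<in>F. n i *\<^sub>R f i)" "integrable \<nu> (\<lambda>z. f (r z))"
      unfolding \<nu>_def using intM[of f] by (simp_all add: integral_distr integrable_distr_eq c_def)
  qed
  have wc: "weak_cost p \<mu> \<nu> \<le> (\<integral>\<^sup>+z. ennreal (norm (z - (\<integral>y. H (r z) (r y) *\<^sub>R y \<partial>\<mu>)) powr p) \<partial>\<nu>)"
  proof (rule weak_cost_density_kernel_le[OF \<nu> m(1,2)])
    have "(\<lambda>x. H (r (fst x)) (r (snd x))) \<in> borel_measurable (borel \<Otimes>\<^sub>M borel)"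
    proof (rule measurable_compose_countable'[where I=F and g="\<lambda>x. r (fst x)"])
      show "(\<lambda>x. r (fst x)) \<in> borel \<Otimes>\<^sub>M borel \<rightarrow>\<^sub>M count_space F"
        by (rule measurable_count_space_extend[of F UNIV]) (use rF in auto)
      show "(\<lambda>x. H i (r (snd x))) \<in> borel_measurable (borel \<Otimes>\<^sub>M borel)" for i
        using measurable_compose[OF measurable_compose[OF measurable_snd rm], of "H i" borel] by simp
    qed (use F in \<open>simp add: countable_finite\<close>)
    then show "(\<lambda>(z, y). H (r z) (r y)) \<in> borel_measurable (borel \<Otimes>\<^sub>M borel)"
      by (simp add: case_prod_beta')
    show "0 \<le> H (r z) (r y)" for z y by (rule H0[OF rF rF])
    show "(\<integral>\<^sup>+y. ennreal (H (r z) (r y)) \<partial>\<mu>) = 1" for z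
    proof -
      have "(\<integral>\<^sup>+y. ennreal (H (r z) (r y)) \<partial>\<mu>) = ennreal (\<integral>y. H (r z) (r y) \<partial>\<mu>)"
        by (rule nn_integral_eq_integral[OF int\<mu>(2)[of "H (r z)"]]) (simp add: H0 rF)
      also have "(\<integral>y. H (r z) (r y) \<partial>\<mu>) = (\<Sum>j\<in>F. q j * H (r z) j)" using int\<mu>(1)[of "H (r z)"] by simp
      also have "\<dots> = 1"
      proof (cases "n (r z) = 0")
        case False
        have "(\<Sum>j\<in>F. q j * H (r z) j) = (\<Sum>j\<in>F. \<rho> (r z) j / n (r z))"
          using False qg[OF rF[of z]] by (intro sum.cong) (simp_all add: H_def)
        then show ?thesis using False \<rho>n[OF rF] by (simp add: sum_divide_distrib[symmetric])
      qed (simp add: H_def sumq)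
      finally show ?thesis by simp
    qed
    show "AE y in \<mu>. (\<integral>\<^sup>+z. ennreal (H (r z) (r y)) \<partial>\<nu>) = 1"
      using AE_finite_valued_nonnull[OF N.finite_measure_axioms F rm\<mu> r]
    proof eventually_elim
      case (elim y)
      then have q: "q (r y) \<noteq> 0" by (simp add: q_def m(3))
      have "(\<integral>\<^sup>+z. ennreal (H (r z) (r y)) \<partial>\<nu>) = ennreal (\<integral>z. H (r z) (r y) \<partial>\<nu>)"
        by (rule nn_integral_eq_integral[OF \<nu>r(2)[of "\<lambda>i. H i (r y)"]]) (simp add: H0 rF)
      also have "(\<integral>z. H (r z) (r y) \<partial>\<nu>) = (\<Sum>i\<in>F. n i * H i (r y))" using \<nu>r(1)[of "\<lambda>i. H i (r y)"] by simp
      also have "\<dots> = (\<Sum>i\<in>F. \<rho> i (r y) / q (r y))"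
        using \<rho>n0[OF _ rF[of y]] by (intro sum.cong) (auto simp: H_def g_def)
      also have "\<dots> = 1" using q \<rho>q[OF rF[of y]] by (simp add: sum_divide_distrib[symmetric])
      finally show ?case by simp
    qed
  qed

  have yO: "AE y in \<mu>. y \<in> \<Omega>" by (rule m(4)[OF \<Omega>b])
  have gm[measurable]: "(\<lambda>y. g i (r y)) \<in> borel_measurable borel" for i
    using measurable_compose[OF rm, of "g i" borel] by simp
  \<comment> \<open>\<open>B i\<close> is the mass of row \<open>i\<close> times its barycenter, and \<open>E i\<close> below its distance from the moment of \<open>S\<close>.\<close>
  define B where "B i = (\<integral>y. g i (r y) *\<^sub>R y \<partial>\<mu>)" for i
  have iB: "integrable \<mu> (\<lambda>y. g i (r y) *\<^sub>R y)" and nB: "norm (B i) \<le> R * n i" if i: "i \<in> F" for i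
  proof -
    have int: "integrable \<mu> (\<lambda>y. g i (r y) * R)" using int\<mu>(2)[of "\<lambda>j. g i j * R"] .
    have le: "AE y in \<mu>. norm (g i (r y) *\<^sub>R y) \<le> g i (r y) * R"
      using yO by eventually_elim (use g0[OF i rF] R in \<open>auto intro: mult_left_mono\<close>)
    show "integrable \<mu> (\<lambda>y. g i (r y) *\<^sub>R y)"
      by (rule Bochner_Integration.integrable_bound[OF int]) (use le in \<open>auto elim!: eventually_mono\<close>)
    then have "norm (B i) \<le> (\<integral>y. g i (r y) * R \<partial>\<mu>)"
      unfolding B_def by (intro order_trans[OF integral_norm_bound] integral_mono_AE le int integrable_norm)
    also have "\<dots> = R * n i" using g_int[OF i] by simp
    finally show "norm (B i) \<le> R * n i" .
  qed
  have bary: "(\<integral>y. H i (r y) *\<^sub>R y \<partial>\<mu>) = (1 / n i) *\<^sub>R B i" if "n i \<noteq> 0" for i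
  proof -
    have "(\<integral>y. H i (r y) *\<^sub>R y \<partial>\<mu>) = (\<integral>y. (1 / n i) *\<^sub>R (g i (r y) *\<^sub>R y) \<partial>\<mu>)"
      using that by (intro Bochner_Integration.integral_cong) (simp_all add: H_def)
    then show ?thesis by (simp only: B_def integral_scaleR_right)
  qed
  have B\<rho>: "norm (B i - (\<Sum>j\<in>F. \<rho> i j *\<^sub>R j)) \<le> \<delta> * n i" if i: "i \<in> F" for i
  proof -
    have r': "(\<integral>y. g i (r y) *\<^sub>R r y \<partial>\<mu>) = (\<Sum>j\<in>F. \<rho> i j *\<^sub>R j)"
      using int\<mu>(1)[of "\<lambda>j. g i j *\<^sub>R j"] qg[OF i] by simp
    have ir: "integrable \<mu> (\<lambda>y. g i (r y) *\<^sub>R r y)" by (rule int\<mu>(2)[of "\<lambda>j. g i j *\<^sub>R j"])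
    have ig: "integrable \<mu> (\<lambda>y. g i (r y) * \<delta>)" by (rule int\<mu>(2)[of "\<lambda>j. g i j * \<delta>"])
    have "B i - (\<Sum>j\<in>F. \<rho> i j *\<^sub>R j) = (\<integral>y. g i (r y) *\<^sub>R y - g i (r y) *\<^sub>R r y \<partial>\<mu>)"
      unfolding B_def r'[symmetric] using iB[OF i] ir by simp
    also have "norm \<dots> \<le> (\<integral>y. g i (r y) * \<delta> \<partial>\<mu>)"
    proof (intro order_trans[OF integral_norm_bound] integral_mono_AE ig integrable_norm
          Bochner_Integration.integrable_diff iB[OF i] ir)
      show "AE y in \<mu>. norm (g i (r y) *\<^sub>R y - g i (r y) *\<^sub>R r y) \<le> g i (r y) * \<delta>"
        using yO
      proof eventually_elim
        case (elim y)
        have "norm (g i (r y) *\<^sub>R y - g i (r y) *\<^sub>R r y) = g i (r y) * norm (y - r y)"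
          using g0[OF i rF] by (simp add: scaleR_diff_right[symmetric])
        also have "\<dots> \<le> g i (r y) * \<delta>" using g0[OF i rF] rd[OF elim] by (intro mult_left_mono)
        finally show ?case .
      qed
    qed
    also have "\<dots> = \<delta> * n i" using g_int[OF i] by simp
    finally show ?thesis .
  qed
  define E where "E i = norm (mS i - B i)" for i
  have E0: "0 \<le> E i" for i by (simp add: E_def)
  have sumE: "(\<Sum>i\<in>F. E i) \<le> 2 * \<delta>"
  proof -
    have "(\<Sum>i\<in>F. E i) \<le> (\<Sum>i\<in>F. norm (mS i - (\<Sum>j\<in>F. \<rho> i j *\<^sub>R j)) + \<delta> * n i)"
    proof (rule sum_mono)
      fix i assume i: "i \<in> F"
      have "E i \<le> norm (mS i - (\<Sum>j\<in>F. \<rho> i j *\<^sub>R j)) + norm ((\<Sum>j\<in>F. \<rho> i j *\<^sub>R j) - B i)"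
        unfolding E_def by (rule norm_triangle_sub_via)
      then show "E i \<le> norm (mS i - (\<Sum>j\<in>F. \<rho> i j *\<^sub>R j)) + \<delta> * n i"
        using B\<rho>[OF i] by (simp add: norm_minus_commute)
    qed
    also have "\<dots> = (\<Sum>i\<in>F. norm (mS i - (\<Sum>j\<in>F. \<rho> i j *\<^sub>R j))) + \<delta>"
      by (simp add: sum.distrib sum_distrib_left[symmetric] sumn)
    finally show ?thesis using \<rho>S by simp
  qed

  define d where "d x = norm (T x - S x)" for x
  have dm[measurable]: "d \<in> borel_measurable M" unfolding d_def by measurable
  have d0: "0 \<le> d x" for x by (simp add: d_def)
  have dR: "AE x in M. d x \<le> 2 * R"
    using T(2) S(2)
  proof eventually_elim
    case (elim x)
    then show ?case unfolding d_def
      using norm_triangle_ineq4[of "T x" "S x"] R(1)[of "T x"] R(1)[of "S x"] by simp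
  qed
  have id: "integrable M d"
    using dR d0 by (intro M.integrable_const_bound[of _ "2 * R"]) (auto elim!: eventually_mono)
  have idp: "integrable M (\<lambda>x. d x powr p)"
    using dR d0 p by (intro M.integrable_const_bound[of _ "(2 * R) powr p"])
      (auto elim!: eventually_mono intro: powr_mono2)
  have iS: "integrable M S" by (intro integrable_AE_compact[OF M.finite_measure_axioms S \<Omega>])
  note ind = integrable_indicator_finite_measure[OF M.finite_measure_axioms A]
  have iAd: "integrable M (\<lambda>x. indicator (A i) x * d x)" for i
    using integrable_mult_indicator[OF A id] by simp
  have iAdp: "integrable M (\<lambda>x. indicator (A i) x * d x powr p)" for i
    using integrable_mult_indicator[OF A idp] by simp
  have iAS: "integrable M (\<lambda>x. indicator (A i) x *\<^sub>R S x)" for i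
    using A iS by (rule integrable_mult_indicator)
  have indn: "(\<integral>x. indicator (A i) x \<partial>M) = n i" for i by (simp add: n_def)
  have intd0: "0 \<le> (\<integral>x. indicator (A i) x * d x \<partial>M)" for i
    by (rule integral_nonneg_AE) (simp add: d0)
  \<comment> \<open>The mean of \<open>|T - S|\<close> over the cell \<open>i\<close>, which is \<open>0\<close> for a cell without mass as \<open>x / 0 = 0\<close>.\<close>
  define a where "a i = (\<integral>x. indicator (A i) x * d x \<partial>M) / n i" for i
  have a0: "0 \<le> a i" for i unfolding a_def by (intro divide_nonneg_nonneg intd0 n0)
  have an: "a i * n i = (\<integral>x. indicator (A i) x * d x \<partial>M)" for i
  proof (cases "n i = 0")
    case True
    have "(\<integral>x. indicator (A i) x * d x \<partial>M) \<le> (\<integral>x. indicator (A i) x * (2 * R) \<partial>M)"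
      by (rule integral_mono_AE[OF iAd integrable_mult_left[OF ind]])
        (use dR in \<open>auto elim!: eventually_mono intro: mult_left_mono\<close>)
    also have "\<dots> = 0" using indn[of i] True by simp
    finally show ?thesis using True intd0[of i] by simp
  qed (simp add: a_def)
  have a2R: "a i \<le> 2 * R" if "n i \<noteq> 0" for i
  proof -
    have "a i * n i \<le> (\<integral>x. indicator (A i) x * (2 * R) \<partial>M)"
      unfolding an
      by (rule integral_mono_AE[OF iAd integrable_mult_left[OF ind]])
        (use dR in \<open>auto elim!: eventually_mono intro: mult_left_mono\<close>)
    also have "\<dots> = 2 * R * n i" using indn[of i] by simp
    finally show ?thesis using that n0[of i] by simp
  qed
  have E2R: "E i \<le> 2 * R * n i" if "i \<in> F" for i
  proof -
    have "norm (mS i) \<le> (\<integral>x. indicator (A i) x * R \<partial>M)"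
      unfolding mS_def
    proof (intro order_trans[OF integral_norm_bound] integral_mono_AE integrable_norm iAS integrable_mult_left[OF ind])
      show "AE x in M. norm (indicator (A i) x *\<^sub>R S x) \<le> indicator (A i) x * R"
        using S(2) by eventually_elim (use R in \<open>auto simp: indicator_def\<close>)
    qed
    also have "\<dots> = R * n i" using indn[of i] by simp
    finally show ?thesis using nB[OF that] norm_triangle_ineq4[of "mS i" "B i"] by (simp add: E_def)
  qed

  \<comment> \<open>The bound on cell \<open>i\<close>: two roundings of \<open>T\<close> cost \<open>2 * \<delta>\<close>, the moment error costs \<open>E i / n i\<close>.
    The constant \<open>K\<close> is adapted to \<open>a i + 2 * \<delta> + E i / n i \<le> 2 * R + 2 + 2 * R\<close>.\<close>
  define G where "G i = a i powr p + K * (2 * \<delta> + E i / n i)" for i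
  have G0: "0 \<le> G i" for i unfolding G_def using K0 \<delta> E0 n0 by (intro add_nonneg_nonneg mult_nonneg_nonneg) auto
  have pt: "AE x in M. norm (T x - (\<integral>y. H (c x) (r y) *\<^sub>R y \<partial>\<mu>)) powr p \<le> G (c x)"
    using T(2) AE_finite_valued_nonnull[OF M.finite_measure_axioms F cm cF]
  proof eventually_elim
    case (elim x)
    define i where "i = c x"
    have i: "i \<in> F" using cF by (auto simp: i_def)
    have ni: "n i \<noteq> 0" using elim(2) by (simp add: n_def A_def i_def)
    then have ni': "0 < n i" using n0[of i] by simp
    have "n i *\<^sub>R T x - mS i = (\<integral>x'. indicator (A i) x' *\<^sub>R T x - indicator (A i) x' *\<^sub>R S x' \<partial>M)"
    proof -
      have "(\<integral>x'. indicator (A i) x' *\<^sub>R T x \<partial>M) = n i *\<^sub>R T x"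
        by (simp add: integral_scaleR_left[OF ind] n_def)
      then show ?thesis
        unfolding mS_def by (simp add: Bochner_Integration.integral_diff[OF integrable_scaleR_left[OF ind] iAS])
    qed
    also have "norm \<dots> \<le> (\<integral>x'. indicator (A i) x' * (2 * \<delta>) + indicator (A i) x' * d x' \<partial>M)"
    proof (intro order_trans[OF integral_norm_bound] integral_mono_AE integrable_norm
        Bochner_Integration.integrable_diff Bochner_Integration.integrable_add iAS iAd
        integrable_mult_left[OF ind] integrable_scaleR_left ind)
      show "AE x' in M. norm (indicator (A i) x' *\<^sub>R T x - indicator (A i) x' *\<^sub>R S x')
          \<le> indicator (A i) x' * (2 * \<delta>) + indicator (A i) x' * d x'"
        using T(2)
      proof eventually_elim
        case x': (elim x')
        show ?case
        proof (cases "x' \<in> A i")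
          case True
          then have "r (T x') = r (T x)" by (simp add: A_def i_def c_def)
          then have "norm (T x - T x') \<le> \<delta> + \<delta>"
            using norm_triangle_sub_via[of "T x" "T x'" "r (T x)"] rd[OF elim(1)] rd[OF x']
            by (simp add: norm_minus_commute)
          then show ?thesis
            using True norm_triangle_sub_via[of "T x" "S x'" "T x'"] by (simp add: d_def)
        qed simp
      qed
    qed
    also have "\<dots> = 2 * \<delta> * n i + a i * n i"
      by (subst Bochner_Integration.integral_add) (simp_all add: iAd ind an[unfolded n_def] n_def)
    finally have "norm (n i *\<^sub>R T x - mS i) \<le> 2 * \<delta> * n i + a i * n i" .
    then have nb: "norm (n i *\<^sub>R T x - B i) \<le> 2 * \<delta> * n i + a i * n i + E i"
      using norm_triangle_sub_via[of "n i *\<^sub>R T x" "B i" "mS i"] by (simp add: E_def)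
    have "T x - (1 / n i) *\<^sub>R B i = (1 / n i) *\<^sub>R (n i *\<^sub>R T x - B i)"
      using ni by (simp add: scaleR_diff_right)
    then have "norm (T x - (1 / n i) *\<^sub>R B i) = norm (n i *\<^sub>R T x - B i) / n i"
      using ni' by simp
    also have "\<dots> \<le> (2 * \<delta> * n i + a i * n i + E i) / n i"
      using nb ni' by (intro divide_right_mono) auto
    also have "\<dots> = a i + (2 * \<delta> + E i / n i)" using ni by (simp add: field_simps)
    finally have "norm (T x - (1 / n i) *\<^sub>R B i) powr p \<le> (a i + (2 * \<delta> + E i / n i)) powr p"
      using p by (intro powr_mono2) auto
    also have "\<dots> \<le> G i"
      unfolding G_def K_def
    proof (rule powr_add_le_linear[OF p a0])
      show "0 \<le> 2 * \<delta> + E i / n i" using \<delta> E0 n0 by simp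
      have "E i / n i \<le> 2 * R" using E2R[OF i] ni' by (simp add: divide_le_eq)
      then show "a i + (2 * \<delta> + E i / n i) \<le> 4 * R + 2" using a2R[OF ni] \<delta> by simp
    qed
    finally show ?case using bary[OF ni] by (simp add: i_def)
  qed

  have "(\<integral>\<^sup>+z. ennreal (norm (z - (\<integral>y. H (r z) (r y) *\<^sub>R y \<partial>\<mu>)) powr p) \<partial>\<nu>)
      = (\<integral>\<^sup>+x. ennreal (norm (T x - (\<integral>y. H (c x) (r y) *\<^sub>R y \<partial>\<mu>)) powr p) \<partial>M)"
  proof -
    have "(\<integral>\<^sup>+z. ennreal (norm (z - b z) powr p) \<partial>\<nu>) = (\<integral>\<^sup>+x. ennreal (norm (T x - b (T x)) powr p) \<partial>M)"
      if [measurable]: "b \<in> borel_measurable borel" for b :: "'a \<Rightarrow> 'a"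
      unfolding \<nu>_def by (rule nn_integral_distr) measurable
    moreover have "(\<lambda>z. \<integral>y. H (r z) (r y) *\<^sub>R y \<partial>\<mu>) \<in> borel_measurable borel"
      using measurable_compose[OF rm, of "\<lambda>i. \<integral>y. H i (r y) *\<^sub>R y \<partial>\<mu>" borel] by simp
    ultimately show ?thesis unfolding c_def .
  qed
  also have "\<dots> \<le> (\<integral>\<^sup>+x. ennreal (G (c x)) \<partial>M)"
    using pt by (intro nn_integral_mono_AE) (auto elim!: eventually_mono intro: ennreal_leI)
  also have "\<dots> = ennreal (\<integral>x. G (c x) \<partial>M)"
    by (rule nn_integral_eq_integral[OF intM(2)]) (simp add: G0)
  also have "(\<integral>x. G (c x) \<partial>M) = (\<Sum>i\<in>F. n i * G i)" using intM(1)[of G] by simp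
  also have "\<dots> \<le> (\<integral>x. d x powr p \<partial>M) + 4 * K * \<delta>"
  proof -
    have "(\<Sum>i\<in>F. n i * G i) \<le> (\<Sum>i\<in>F. (\<integral>x. indicator (A i) x * d x powr p \<partial>M) + K * (2 * \<delta>) * n i + K * E i)"
    proof (rule sum_mono)
      fix i assume "i \<in> F"
      have "n i * a i powr p \<le> (\<integral>x. indicator (A i) x * d x powr p \<partial>M)"
        unfolding n_def
        by (rule powr_mean_le[OF M.finite_measure_axioms p A id idp _ _ a0])
          (use d0 an[of i] in \<open>auto simp: n_def\<close>)
      moreover have "n i * (K * (E i / n i)) \<le> K * E i" using K0 E0[of i] by simp
      ultimately show "n i * G i \<le> (\<integral>x. indicator (A i) x * d x powr p \<partial>M) + K * (2 * \<delta>) * n i + K * E i"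
        unfolding G_def by (simp add: distrib_left mult_ac)
    qed
    also have "\<dots> = (\<Sum>i\<in>F. \<integral>x. indicator (A i) x * d x powr p \<partial>M) + K * (2 * \<delta>) + K * (\<Sum>i\<in>F. E i)"
      by (simp add: sum.distrib sum_distrib_left[symmetric] sumn)
    also have "(\<Sum>i\<in>F. \<integral>x. indicator (A i) x * d x powr p \<partial>M) = (\<integral>x. d x powr p \<partial>M)"
    proof -
      have "(\<Sum>i\<in>F. \<integral>x. indicator (A i) x * d x powr p \<partial>M) = (\<integral>x. (\<Sum>i\<in>F. indicator (A i) x * d x powr p) \<partial>M)"
        by (rule Bochner_Integration.integral_sum[symmetric]) (rule iAdp)
      also have "\<dots> = (\<integral>x. d x powr p \<partial>M)"
      proof (rule Bochner_Integration.integral_cong[OF refl])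
        fix x assume "x \<in> space M"
        then have "(\<Sum>i\<in>F. indicator (A i) x * d x powr p) = (\<Sum>i\<in>F. if c x = i then d x powr p else 0)"
          by (intro sum.cong) (auto simp: A_def)
        then show "(\<Sum>i\<in>F. indicator (A i) x * d x powr p) = d x powr p" using F cF by auto
      qed
      finally show ?thesis .
    qed
    finally show ?thesis using mult_left_mono[OF sumE K0] by simp
  qed
  finally show ?thesis using wc unfolding \<nu>_def d_def by (auto intro: order_trans ennreal_leI)
qed

text \<open>
  The hard half of Strassen's theorem in the form needed here: the weak cost sees only the
  transport from \<open>T\<close> to \<open>S\<close>, while spreading the law of \<open>S\<close> to the larger measure \<open>\<mu>\<close> is free.
\<close>

lemma weak_cost_le_transport:
  fixes M :: "'b measure" and \<mu> :: "'a::euclidean_space measure" and S T :: "'b \<Rightarrow> 'a"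
  assumes \<Omega>: "compact \<Omega>" and p: "1 < p" and M: "prob_space M"
    and T: "T \<in> borel_measurable M" "AE x in M. T x \<in> \<Omega>"
    and S: "S \<in> borel_measurable M" "AE x in M. S x \<in> \<Omega>"
    and cx: "distr M borel S \<le>\<^sub>c\<^sub>x \<mu>" and \<mu>: "\<mu> \<in> prob_on \<Omega>"
  shows "weak_cost p \<mu> (distr M borel T) \<le> (\<integral>\<^sup>+x. ennreal (norm (T x - S x) powr p) \<partial>M)"
proof (cases "(\<integral>\<^sup>+x. ennreal (norm (T x - S x) powr p) \<partial>M) = \<infinity>")
  case False
  obtain R where R: "\<And>y. y \<in> \<Omega> \<Longrightarrow> norm y \<le> R" "0 \<le> R"
    using compact_imp_bounded[OF \<Omega>] by (metis bounded_pos less_imp_le)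
  note [measurable] = S(1) T(1)
  define K where "K = p * (4 * R + 2) powr (p - 1)"
  have K: "0 \<le> K" using p by (simp add: K_def)
  have "integrable M (\<lambda>x. norm (T x - S x) powr p)"
    using False by (auto simp: integrable_iff_bounded less_top[symmetric])
  then have eq: "(\<integral>\<^sup>+x. ennreal (norm (T x - S x) powr p) \<partial>M) = ennreal (\<integral>x. norm (T x - S x) powr p \<partial>M)"
    by (rule nn_integral_eq_integral) simp
  show ?thesis
  proof (rule ennreal_le_epsilon)
    fix e :: real assume e: "0 < e"
    define \<delta> where "\<delta> = min 1 (e / (4 * K + 1))"
    have \<delta>: "0 < \<delta>" "\<delta> \<le> 1" "\<delta> \<le> e / (4 * K + 1)" using e K by (auto simp: \<delta>_def)
    have "4 * K * \<delta> \<le> (4 * K + 1) * (e / (4 * K + 1))" using \<delta> K by (intro mult_mono) auto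
    also have "\<dots> = e" using K by simp
    finally have Ke: "4 * K * \<delta> \<le> e" .
    have "weak_cost p \<mu> (distr M borel T) \<le> ennreal ((\<integral>x. norm (T x - S x) powr p \<partial>M) + 4 * K * \<delta>)"
      unfolding K_def by (rule weak_cost_le_transport_approx[OF assms R \<delta>(1,2)])
    also have "\<dots> \<le> ennreal ((\<integral>x. norm (T x - S x) powr p \<partial>M) + e)"
      using Ke by (intro ennreal_leI) simp
    also have "\<dots> = ennreal (\<integral>x. norm (T x - S x) powr p \<partial>M) + ennreal e"
      using e by (intro ennreal_plus) auto
    finally show "weak_cost p \<mu> (distr M borel T) \<le> (\<integral>\<^sup>+x. ennreal (norm (T x - S x) powr p) \<partial>M) + ennreal e"
      unfolding eq .
  qed
qed simp

section \<open>Optimality of the geodesic\<close>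

text \<open>
  A bound for all weighted sums passes to the infima. Nonemptiness matters: the infimum over the
  empty set is infinite, but a zero weight would hide it.
\<close>

lemma ennreal_le_weighted_INF_add:
  fixes f :: "'b \<Rightarrow> ennreal" and g :: "'c \<Rightarrow> ennreal"
  assumes le: "\<And>a b. a \<in> X \<Longrightarrow> b \<in> Y \<Longrightarrow> L \<le> ennreal s * f a + ennreal t * g b"
    and "X \<noteq> {}" "Y \<noteq> {}" "0 \<le> s" "s \<le> 1" "0 \<le> t" "t \<le> 1"
  shows "L \<le> ennreal s * (INF a\<in>X. f a) + ennreal t * (INF b\<in>Y. g b)"
proof (cases "ennreal s * (INF a\<in>X. f a) = \<infinity> \<or> ennreal t * (INF b\<in>Y. g b) = \<infinity>")
  case True
  then show ?thesis by auto
next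
  case False
  have approx: "\<exists>a\<in>X. ennreal s * f a \<le> ennreal s * (INF a\<in>X. f a) + ennreal e"
    if "X \<noteq> {}" "0 \<le> s" "s \<le> 1" "ennreal s * (INF a\<in>X. f a) \<noteq> \<infinity>" "0 < e"
    for X :: "'d set" and f :: "'d \<Rightarrow> ennreal" and s e
  proof (cases "s = 0")
    case True
    then show ?thesis using that by auto
  next
    case False
    then have "(INF a\<in>X. f a) \<noteq> \<infinity>" using that by (auto simp: ennreal_mult_eq_top_iff)
    from INF_approx_ennreal[OF \<open>0 < e\<close> refl this] obtain a
      where a: "a \<in> X" "f a < (INF a\<in>X. f a) + ennreal e" by blast
    have "ennreal s * f a \<le> ennreal s * (INF a\<in>X. f a) + ennreal s * ennreal e"
      unfolding distrib_left[symmetric] using a by (intro mult_left_mono) auto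
    also have "\<dots> \<le> ennreal s * (INF a\<in>X. f a) + 1 * ennreal e"
      using that by (intro add_left_mono mult_right_mono) auto
    finally show ?thesis using a(1) by auto
  qed
  show ?thesis
  proof (rule ennreal_le_epsilon)
    fix e :: real assume e: "0 < e"
    obtain a b where ab: "a \<in> X" "ennreal s * f a \<le> ennreal s * (INF a\<in>X. f a) + ennreal (e / 2)"
       "b \<in> Y" "ennreal t * g b \<le> ennreal t * (INF b\<in>Y. g b) + ennreal (e / 2)"
      using approx[of X s f "e / 2"] approx[of Y t g "e / 2"] False assms e by auto
    have "L \<le> ennreal s * f a + ennreal t * g b" using le ab by blast
    also have "\<dots> \<le> (ennreal s * (INF a\<in>X. f a) + ennreal (e / 2)) + (ennreal t * (INF b\<in>Y. g b) + ennreal (e / 2))"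
      using ab by (intro add_mono)
    also have "\<dots> = ennreal s * (INF a\<in>X. f a) + ennreal t * (INF b\<in>Y. g b) + (ennreal (e / 2) + ennreal (e / 2))"
      by (simp add: ac_simps)
    also have "ennreal (e / 2) + ennreal (e / 2) = ennreal e"
      using e by (subst ennreal_plus[symmetric]) auto
    finally show "L \<le> ennreal s * (INF a\<in>X. f a) + ennreal t * (INF b\<in>Y. g b) + ennreal e" .
  qed
qed

text \<open>
  The product coupling, as the density \<open>1\<close>.
\<close>

lemma kernel_coupling_exists:
  fixes \<mu> \<nu> :: "'a::euclidean_space measure"
  assumes "\<mu> \<in> prob_on \<Omega>" "\<nu> \<in> prob_on \<Omega>"
  shows "{(\<gamma>, \<kappa>). \<gamma> \<in> couplings \<mu> \<nu> \<and> disintegrates \<gamma> \<mu> \<kappa>} \<noteq> {}"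
proof -
  interpret M: prob_space \<mu> using assms(1) by (rule prob_onD)
  interpret N: prob_space \<nu> using assms(2) by (rule prob_onD)
  show ?thesis
    using density_kernel[OF M.prob_space_axioms prob_onD(2)[OF assms(1)] N.prob_space_axioms
        prob_onD(2)[OF assms(2)], of "\<lambda>_ _. 1"]
    by (auto simp: M.emeasure_space_1 N.emeasure_space_1)
qed

lemma CMM_le_wC_objective:
  fixes \<mu>1 \<mu>2 \<nu> :: "'a::euclidean_space measure"
  assumes \<Omega>: "compact \<Omega>" "convex \<Omega>" and p: "1 < p" and t: "0 \<le> t" "t \<le> 1"
    and \<mu>: "\<mu>1 \<in> prob_on \<Omega>" "\<mu>2 \<in> prob_on \<Omega>" and \<nu>: "\<nu> \<in> prob_on \<Omega>"
    and le: "\<And>\<eta>. \<eta> \<in> prob_on \<Omega> \<Longrightarrow> \<eta> \<le>\<^sub>c\<^sub>x \<mu>2 \<Longrightarrow> L \<le> CMM \<Omega> p t \<mu>1 \<eta>"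
  shows "L \<le> wC_objective p t \<mu>1 \<mu>2 \<nu>"
  unfolding wC_objective_def weak_cost_def
proof (rule ennreal_le_weighted_INF_add)
  fix a b
  assume ab: "a \<in> {(\<gamma>, \<kappa>). \<gamma> \<in> couplings \<nu> \<mu>2 \<and> disintegrates \<gamma> \<nu> \<kappa>}"
    "b \<in> {(\<gamma>, \<kappa>). \<gamma> \<in> couplings \<mu>1 \<nu> \<and> disintegrates \<gamma> \<mu>1 \<kappa>}"
  obtain \<gamma>2 \<kappa>2 \<gamma>1 \<kappa>1 where e: "a = (\<gamma>2, \<kappa>2)" "b = (\<gamma>1, \<kappa>1)" by fastforce
  have g: "\<gamma>2 \<in> couplings \<nu> \<mu>2" "disintegrates \<gamma>2 \<nu> \<kappa>2" "\<gamma>1 \<in> couplings \<mu>1 \<nu>" "disintegrates \<gamma>1 \<mu>1 \<kappa>1"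
    using ab by (simp_all add: e)
  have k: "\<kappa>1 \<in> borel \<rightarrow>\<^sub>M prob_algebra borel" "\<kappa>2 \<in> borel \<rightarrow>\<^sub>M prob_algebra borel"
    using g by (simp_all add: disintegrates_def)
  obtain \<eta> where \<eta>: "\<eta> \<in> prob_on \<Omega>" "\<eta> \<le>\<^sub>c\<^sub>x \<mu>2"
    "CMM \<Omega> p t \<mu>1 \<eta> \<le> ennreal t * (\<integral>\<^sup>+z. ennreal (norm (z - (\<integral>y. y \<partial>\<kappa>2 z)) powr p) \<partial>\<nu>)
      + ennreal (1 - t) * (\<integral>\<^sup>+x. ennreal (norm (x - (\<integral>z. z \<partial>\<kappa>1 x)) powr p) \<partial>\<mu>1)"
    by (rule CMM_le_kernel_costs[OF \<Omega> p t \<mu>(1) \<nu> \<mu>(2) k(1) disintegration_bind[OF g(3,4)]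
          k(2) disintegration_bind[OF g(1,2)]])
  show "L \<le> ennreal t * (case a of (\<gamma>, \<kappa>) \<Rightarrow> \<integral>\<^sup>+x. ennreal (norm (x - (\<integral>y. y \<partial>\<kappa> x)) powr p) \<partial>\<nu>)
      + ennreal (1 - t) * (case b of (\<gamma>, \<kappa>) \<Rightarrow> \<integral>\<^sup>+x. ennreal (norm (x - (\<integral>y. y \<partial>\<kappa> x)) powr p) \<partial>\<mu>1)"
    using order_trans[OF le[OF \<eta>(1,2)] \<eta>(3)] by (simp add: e)
qed (use t kernel_coupling_exists[OF \<nu> \<mu>(2)] kernel_coupling_exists[OF \<mu>(1) \<nu>] in auto)

lemma optimal_mapD:
  fixes \<mu> \<eta> :: "'a::euclidean_space measure"
  assumes "wasserstein_optimal_map p \<mu> \<eta> S" "sets \<mu> = sets borel"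
  shows "S \<in> borel_measurable borel" "distr \<mu> borel S = \<eta>"
    "(\<integral>\<^sup>+x. ennreal (norm (x - S x) powr p) \<partial>\<mu>) = wasserstein_pow p \<mu> \<eta>"
proof -
  let ?\<gamma> = "distr \<mu> (borel \<Otimes>\<^sub>M borel) (\<lambda>x. (x, S x))"
  have [measurable_cong]: "sets \<mu> = sets borel" by fact
  have Sm[measurable]: "S \<in> borel_measurable borel" and 1: "?\<gamma> \<in> couplings \<mu> \<eta>"
    and 2: "(\<integral>\<^sup>+(x, y). ennreal (norm (x - y) powr p) \<partial>?\<gamma>) = wasserstein_pow p \<mu> \<eta>"
    using assms(1) by (simp_all add: wasserstein_optimal_map_def Let_def)
  show "S \<in> borel_measurable borel" by (rule Sm)
  have "distr \<mu> borel S = distr ?\<gamma> borel snd" by (simp add: distr_distr comp_def)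
  then show "distr \<mu> borel S = \<eta>" using 1 by (simp add: couplings_def)
  have "(\<integral>\<^sup>+x. ennreal (norm (x - S x) powr p) \<partial>\<mu>) = (\<integral>\<^sup>+(x, y). ennreal (norm (x - y) powr p) \<partial>?\<gamma>)"
    by (subst nn_integral_distr) auto
  then show "(\<integral>\<^sup>+x. ennreal (norm (x - S x) powr p) \<partial>\<mu>) = wasserstein_pow p \<mu> \<eta>" using 2 by simp
qed

lemma wC_objective_geodesic_le:
  fixes \<mu>1 \<mu>2 :: "'a::euclidean_space measure"
  assumes \<Omega>: "compact \<Omega>" "convex \<Omega>" and p: "1 < p" and t: "0 \<le> t" "t \<le> 1"
    and \<mu>: "\<mu>1 \<in> prob_on \<Omega>" "\<mu>2 \<in> prob_on \<Omega>"
    and S: "S \<in> borel_measurable borel" "distr \<mu>1 borel S \<in> prob_on \<Omega>" "distr \<mu>1 borel S \<le>\<^sub>c\<^sub>x \<mu>2"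
  defines "T \<equiv> \<lambda>x. (1 - geodesic_time p t) *\<^sub>R x + geodesic_time p t *\<^sub>R S x"
  shows "distr \<mu>1 borel T \<in> prob_on \<Omega>"
    "wC_objective p t \<mu>1 \<mu>2 (distr \<mu>1 borel T)
      \<le> ennreal (geodesic_const p t) * (\<integral>\<^sup>+x. ennreal (norm (x - S x) powr p) \<partial>\<mu>1)"
proof -
  define s where "s = geodesic_time p t"
  have s: "0 \<le> s" "s \<le> 1" using geodesic_time_bounds[OF t] by (simp_all add: s_def)
  have T: "T x = (1 - s) *\<^sub>R x + s *\<^sub>R S x" for x by (simp add: T_def s_def)
  have \<Omega>b[measurable]: "\<Omega> \<in> sets borel" using \<Omega>(1) by (simp add: borel_compact)
  note m = prob_onD[OF \<mu>(1)]
  interpret prob_space \<mu>1 by (rule m)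
  have [measurable_cong]: "sets \<mu>1 = sets borel" by (rule m)
  have Sm[measurable]: "S \<in> borel_measurable borel" by (rule S)
  have Tm[measurable]: "T \<in> borel_measurable borel" unfolding T by measurable
  have SO: "AE x in \<mu>1. S x \<in> \<Omega>"
    using prob_onD(4)[OF S(2) \<Omega>b] by (simp add: AE_distr_iff)
  have TO: "AE x in \<mu>1. T x \<in> \<Omega>"
    using SO m(4)[OF \<Omega>b] by eventually_elim (use s \<Omega>(2) in \<open>simp add: T convexD\<close>)
  then show "distr \<mu>1 borel T \<in> prob_on \<Omega>"
    by (intro prob_onI prob_space_distr) (auto simp: AE_distr_iff)
  let ?D = "\<integral>\<^sup>+x. ennreal (norm (x - S x) powr p) \<partial>\<mu>1"
  have "weak_cost p \<mu>2 (distr \<mu>1 borel T) \<le> (\<integral>\<^sup>+x. ennreal (norm (T x - S x) powr p) \<partial>\<mu>1)"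
    by (rule weak_cost_le_transport[OF \<Omega>(1) p m(1) _ TO _ SO S(3) \<mu>(2)]) measurable
  also have "\<dots> = (\<integral>\<^sup>+x. ennreal ((1 - s) powr p) * ennreal (norm (x - S x) powr p) \<partial>\<mu>1)"
  proof (rule nn_integral_cong)
    fix x
    have "T x - S x = (1 - s) *\<^sub>R (x - S x)" by (simp add: T algebra_simps)
    then have "norm (T x - S x) = (1 - s) * norm (x - S x)" using s by simp
    then show "ennreal (norm (T x - S x) powr p) = ennreal ((1 - s) powr p) * ennreal (norm (x - S x) powr p)"
      using s by (simp add: powr_mult ennreal_mult)
  qed
  also have "\<dots> = ennreal ((1 - s) powr p) * ?D" by (rule nn_integral_cmult) measurable
  finally have 1: "weak_cost p \<mu>2 (distr \<mu>1 borel T) \<le> ennreal ((1 - s) powr p) * ?D" .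
  have "weak_cost p (distr \<mu>1 borel T) \<mu>1 \<le> (\<integral>\<^sup>+x. ennreal (norm (x - T x) powr p) \<partial>\<mu>1)"
    by (rule weak_cost_distr_le[OF m(2) Tm])
  also have "\<dots> = (\<integral>\<^sup>+x. ennreal (s powr p) * ennreal (norm (x - S x) powr p) \<partial>\<mu>1)"
  proof (rule nn_integral_cong)
    fix x
    have "x - T x = s *\<^sub>R (x - S x)" by (simp add: T algebra_simps)
    then have "norm (x - T x) = s * norm (x - S x)" using s by simp
    then show "ennreal (norm (x - T x) powr p) = ennreal (s powr p) * ennreal (norm (x - S x) powr p)"
      using s by (simp add: powr_mult ennreal_mult)
  qed
  also have "\<dots> = ennreal (s powr p) * ?D" by (rule nn_integral_cmult) measurable
  finally have 2: "weak_cost p (distr \<mu>1 borel T) \<mu>1 \<le> ennreal (s powr p) * ?D" .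
  have "wC_objective p t \<mu>1 \<mu>2 (distr \<mu>1 borel T)
      \<le> ennreal t * (ennreal ((1 - s) powr p) * ?D) + ennreal (1 - t) * (ennreal (s powr p) * ?D)"
    unfolding wC_objective_def by (intro add_mono mult_left_mono 1 2) auto
  also have "\<dots> = (ennreal (t * (1 - s) powr p) + ennreal ((1 - t) * s powr p)) * ?D"
    using t by (simp add: ennreal_mult distrib_right mult.assoc)
  also have "ennreal (t * (1 - s) powr p) + ennreal ((1 - t) * s powr p) = ennreal (geodesic_const p t)"
    using t unfolding geodesic_const_def s_def by (intro ennreal_plus[symmetric]) auto
  finally show "wC_objective p t \<mu>1 \<mu>2 (distr \<mu>1 borel T) \<le> ennreal (geodesic_const p t) * ?D" .
qed

theorem lemma4p2:
  fixes \<Omega> :: "'a::euclidean_space set"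
    and p t :: real
    and \<mu>1 \<mu>2 \<eta>2 \<nu> :: "'a measure"
    and S :: "'a \<Rightarrow> 'a"
  assumes "compact \<Omega>" and "convex \<Omega>"
    and "1 < p"
    and "\<mu>1 \<in> prob_ac_on \<Omega>"
    and "\<mu>2 \<in> prob_on \<Omega>"
    and "t \<in> {0..1}"
    and "is_arg_min (CMM \<Omega> p t \<mu>1) (\<lambda>\<eta>. \<eta> \<in> prob_on \<Omega> \<and> \<eta> \<le>\<^sub>c\<^sub>x \<mu>2) \<eta>2"
    and "wasserstein_optimal_map p \<mu>1 \<eta>2 S"
    and "\<nu> = distr \<mu>1 borel
           (\<lambda>x. (1 - geodesic_time p t) *\<^sub>R x + geodesic_time p t *\<^sub>R S x)"
  shows "\<nu> \<in> prob_on \<Omega> \<and> wC_objective p t \<mu>1 \<mu>2 \<nu> = wC \<Omega> p t \<mu>1 \<mu>2"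
proof -
  have t: "0 \<le> t" "t \<le> 1" using assms(6) by auto
  have \<mu>1: "\<mu>1 \<in> prob_on \<Omega>" using assms(4) by (simp add: prob_ac_on_def)
  have \<eta>2: "\<eta>2 \<in> prob_on \<Omega>" "\<eta>2 \<le>\<^sub>c\<^sub>x \<mu>2"
    and min: "\<And>\<eta>. \<eta> \<in> prob_on \<Omega> \<Longrightarrow> \<eta> \<le>\<^sub>c\<^sub>x \<mu>2 \<Longrightarrow> CMM \<Omega> p t \<mu>1 \<eta>2 \<le> CMM \<Omega> p t \<mu>1 \<eta>"
    using assms(7) by (auto simp: is_arg_min_def not_less)
  note S = optimal_mapD[OF assms(8) prob_onD(2)[OF \<mu>1]]
  note geo = wC_objective_geodesic_le[OF assms(1-3) t \<mu>1 assms(5) S(1), unfolded S(2), OF \<eta>2,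
      folded assms(9)]
  have "wC_objective p t \<mu>1 \<mu>2 \<nu> \<le> CMM \<Omega> p t \<mu>1 \<eta>2"
    using order_trans[OF geo(2)[unfolded S(3)] CMM_ge_wasserstein[OF \<mu>1 \<eta>2(1) assms(1-3) t]] .
  also have "CMM \<Omega> p t \<mu>1 \<eta>2 \<le> wC \<Omega> p t \<mu>1 \<mu>2"
    unfolding wC_def
    by (intro INF_greatest CMM_le_wC_objective[OF assms(1-3) t \<mu>1 assms(5)] min)
  finally have "wC_objective p t \<mu>1 \<mu>2 \<nu> \<le> wC \<Omega> p t \<mu>1 \<mu>2" .
  moreover have "wC \<Omega> p t \<mu>1 \<mu>2 \<le> wC_objective p t \<mu>1 \<mu>2 \<nu>"
    unfolding wC_def by (rule INF_lower[OF geo(1)])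
  ultimately show ?thesis using geo(1) by auto
qed

end
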